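(* Let $n\ge 1$, let $P$ be a simple $D_n$-module and let $V$ be a simple $\mathfrak{gl}_n$-module (not assumed finite-dimensional). If $T(P,V)$ is reducible as a $\mathfrak g_n$-module (i.e. it has a nonzero proper $\mathfrak g_n$-submodule), then $V\cong V(\delta_r,r)$ for some $r\in\{0,1,\ldots,n\}$.
   Context: All vector spaces and algebras are over $\mathbb C$, and $\otimes=\otimes_{\mathbb C}$. For a positive integer $n$, $A_n=\mathbb C[t_1^{\pm1},\ldots,t_n^{\pm1},x_1,\ldots,x_n]$, $d_i=t_i\frac{\partial}{\partial t_i}+\frac{\partial}{\partial x_i}$, and $\mathfrak g_n=\bigoplus_{i=1}^nA_nd_i$, a Lie subalgebra of $\mathrm{Der}(A_n)$ with bracket $[fd_i,gd_j]=f\,d_i(g)d_j-g\,d_j(f)d_i$ for $f,g\in A_n$. $D_n$ is the associative algebra generated by the commutative algebra $A_n$ and commuting elements $d_1,\ldots,d_n$ subject to $d_if-fd_i=d_i(f)$ for $f\in A_n$ (so $D_n=\bigoplus_{\alpha\in\mathbb Z_{\ge0}^n}A_n d_1^{\alpha_1}\cdots d_n^{\alpha_n}$). $E_{i,j}$ denotes the $n\times n$ matrix unit. For a $D_n$-module $P$ and a $\mathfrak{gl}_n$-module $V$, $T(P,V)=P\otimes V$ is the $\mathfrak g_n$-module with action $$(fd_j)(p\otimes v)=(fd_jp)\otimes v+\sum_{i=1}^n d_i(f)p\otimes E_{i,j}v,\qquad f\in A_n,\ p\in P,\ v\in V,\ 1\le j\le n.$$ For $0\le r\le n$, $V(\delta_r,r)$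 is the simple $\mathfrak{gl}_n$-module on which the identity matrix acts as the scalar $r$ and whose restriction to $\mathfrak{sl}_n$ is the simple highest weight module of highest weight $\delta_r$, where $\delta_r(E_{j,j}-E_{j+1,j+1})=\delta_{rj}$ for $1\le j\le n-1$ (so $\delta_0=\delta_n=0$). It is isomorphic to the exterior power $\bigwedge^r(\mathbb C^n)$ of the natural module. *)

theory Defs
  imports "HOL-Analysis.Analysis" "HOL-Library.Poly_Mapping"
begin

section \<open>Complex vector spaces\<close>

text \<open>The library has only \<open>real_vector\<close> as a type class; this is its analogue over the
  complex numbers.\<close>

class complex_vector = ab_group_add +
  fixes scaleC :: "complex \<Rightarrow> 'a \<Rightarrow> 'a" (infixr \<open>*\<^sub>C\<close> 75)
  assumes scaleC_add_right: "a *\<^sub>C (x + y) = a *\<^sub>C x + a *\<^sub>C y"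
    and scaleC_add_left: "(a + b) *\<^sub>C x = a *\<^sub>C x + b *\<^sub>C x"
    and scaleC_scaleC: "a *\<^sub>C b *\<^sub>C x = (a * b) *\<^sub>C x"
    and scaleC_one: "1 *\<^sub>C x = x"

global_interpretation complex_vector: vector_space "scaleC :: complex \<Rightarrow> 'a \<Rightarrow> 'a::complex_vector"
  by unfold_locales (simp_all add: scaleC_add_right scaleC_add_left scaleC_scaleC scaleC_one)

definition clinear :: "('a::complex_vector \<Rightarrow> 'b::complex_vector) \<Rightarrow> bool" where
  "clinear f \<longleftrightarrow> Vector_Spaces.linear scaleC scaleC f"

definition cbilinear :: "('a::complex_vector \<Rightarrow> 'b::complex_vector \<Rightarrow> 'c::complex_vector) \<Rightarrow> bool" where
  "cbilinear b \<longleftrightarrow> (\<forall>x. clinear (b x)) \<and> (\<forall>y. clinear (\<lambda>x. b x y))"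

lemma clinear_iff:
  "clinear f \<longleftrightarrow> (\<forall>x y. f (x + y) = f x + f y) \<and> (\<forall>c x. f (c *\<^sub>C x) = c *\<^sub>C f x)"
  by (auto simp: clinear_def Vector_Spaces.linear_iff complex_vector.vector_space_axioms)

instantiation complex :: complex_vector
begin
definition scaleC_complex_def: "c *\<^sub>C (x::complex) = c * x"
instance by standard (simp_all add: scaleC_complex_def algebra_simps)
end

instantiation vec :: (complex_vector, finite) complex_vector
begin
definition scaleC_vec_def: "c *\<^sub>C (x::'a^'b) = (\<chi> i. c *\<^sub>C (x $ i))"
instance
  by standard (simp_all add: scaleC_vec_def vec_eq_iff scaleC_add_right scaleC_add_left
      scaleC_scaleC scaleC_one)
end

instantiation poly_mapping :: (type, complex_vector) complex_vector
begin
definition scaleC_poly_mapping_def: "c *\<^sub>C f = Poly_Mapping.map (scaleC c) f"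
instance
proof
  have *: "Poly_Mapping.lookup (c *\<^sub>C f) k = c *\<^sub>C Poly_Mapping.lookup f k"
    for c and f :: "'a \<Rightarrow>\<^sub>0 'b" and k
    by (auto simp: scaleC_poly_mapping_def Poly_Mapping.map.rep_eq when_def)
  fix a b :: complex and x y :: "'a \<Rightarrow>\<^sub>0 'b"
  show "a *\<^sub>C (x + y) = a *\<^sub>C x + a *\<^sub>C y" "(a + b) *\<^sub>C x = a *\<^sub>C x + b *\<^sub>C x"
    "a *\<^sub>C b *\<^sub>C x = (a * b) *\<^sub>C x" "1 *\<^sub>C x = x"
    by (auto intro!: poly_mapping_eqI simp: * lookup_add scaleC_add_right scaleC_add_left
        scaleC_scaleC scaleC_one)
qed
end

lemma lookup_scaleC [simp]: "Poly_Mapping.lookup (c *\<^sub>C f) k = c *\<^sub>C Poly_Mapping.lookup f k"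
  by (auto simp: scaleC_poly_mapping_def Poly_Mapping.map.rep_eq when_def)

lemma scaleC_single [simp]: "c *\<^sub>C Poly_Mapping.single k a = Poly_Mapping.single k (c *\<^sub>C a)"
  by (rule poly_mapping_eqI) (simp add: lookup_single when_def)

text \<open>The type \<open>'k \<Rightarrow>\<^sub>0 complex\<close> is the complex vector space with basis \<open>'k\<close>;
  \<open>lin_ext g\<close> is the linear map on it sending the basis vector \<open>k\<close> to \<open>g k\<close>.\<close>

definition lin_ext :: "('k \<Rightarrow> 'b::complex_vector) \<Rightarrow> ('k \<Rightarrow>\<^sub>0 complex) \<Rightarrow> 'b" where
  "lin_ext g z = (\<Sum>k\<in>Poly_Mapping.keys z. Poly_Mapping.lookup z k *\<^sub>C g k)"

lemma lin_ext_superset: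
  assumes "finite K" "Poly_Mapping.keys z \<subseteq> K"
  shows "lin_ext g z = (\<Sum>k\<in>K. Poly_Mapping.lookup z k *\<^sub>C g k)"
  unfolding lin_ext_def
  by (rule sum.mono_neutral_left) (use assms in \<open>auto simp: in_keys_iff\<close>)

lemma lin_ext_add: "lin_ext g (y + z) = lin_ext g y + lin_ext g z"
proof -
  let ?K = "Poly_Mapping.keys y \<union> Poly_Mapping.keys z"
  have "Poly_Mapping.keys (y + z) \<subseteq> ?K" by (rule Poly_Mapping.keys_add)
  then show ?thesis
    by (simp add: lin_ext_superset[of ?K] lookup_add scaleC_add_left sum.distrib)
qed

lemma lin_ext_scaleC: "lin_ext g (c *\<^sub>C z) = c *\<^sub>C lin_ext g z"
proof -
  have "Poly_Mapping.keys (c *\<^sub>C z) \<subseteq> Poly_Mapping.keys z"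
    by (auto simp: in_keys_iff)
  then show ?thesis
    by (simp add: lin_ext_superset[of "Poly_Mapping.keys z"] complex_vector.scale_sum_right
        scaleC_complex_def)
qed

lemma clinear_lin_ext: "clinear (lin_ext g)"
  by (simp add: clinear_iff lin_ext_add lin_ext_scaleC)

lemma lin_ext_single [simp]: "lin_ext g (Poly_Mapping.single k c) = c *\<^sub>C g k"
  by (simp add: lin_ext_superset[of "{k}"])

section \<open>Tensor products\<close>

text \<open>\<open>P \<otimes> V\<close> is the free vector space on \<open>P \<times> V\<close> modulo the
  smallest linear congruence that makes \<open>(p, v) \<mapsto> p \<otimes> v\<close> bilinear.\<close>

inductive tensor_rel ::
  "('p::complex_vector \<times> 'v::complex_vector \<Rightarrow>\<^sub>0 complex) \<Rightarrow> ('p \<times> 'v \<Rightarrow>\<^sub>0 complex) \<Rightarrow> bool" where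
  tensor_refl: "tensor_rel x x"
| tensor_sym: "tensor_rel x y \<Longrightarrow> tensor_rel y x"
| tensor_trans: "tensor_rel x y \<Longrightarrow> tensor_rel y z \<Longrightarrow> tensor_rel x z"
| tensor_add: "tensor_rel x x' \<Longrightarrow> tensor_rel y y' \<Longrightarrow> tensor_rel (x + y) (x' + y')"
| tensor_scale: "tensor_rel x x' \<Longrightarrow> tensor_rel (c *\<^sub>C x) (c *\<^sub>C x')"
| tensor_add_left:
    "tensor_rel (Poly_Mapping.single (p + p', v) 1)
       (Poly_Mapping.single (p, v) 1 + Poly_Mapping.single (p', v) 1)"
| tensor_add_right:
    "tensor_rel (Poly_Mapping.single (p, v + v') 1)
       (Poly_Mapping.single (p, v) 1 + Poly_Mapping.single (p, v') 1)"
| tensor_scale_left: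
    "tensor_rel (Poly_Mapping.single (c *\<^sub>C p, v) 1) (c *\<^sub>C Poly_Mapping.single (p, v) 1)"
| tensor_scale_right:
    "tensor_rel (Poly_Mapping.single (p, c *\<^sub>C v) 1) (c *\<^sub>C Poly_Mapping.single (p, v) 1)"

quotient_type (overloaded) ('p, 'v) tensor =
  "'p::complex_vector \<times> 'v::complex_vector \<Rightarrow>\<^sub>0 complex" / tensor_rel
  by (intro equivpI reflpI sympI transpI) (blast intro: tensor_refl tensor_sym tensor_trans)+

instantiation tensor :: (complex_vector, complex_vector) complex_vector
begin
lift_definition zero_tensor :: "('a, 'b) tensor" is 0 .
lift_definition plus_tensor :: "('a, 'b) tensor \<Rightarrow> ('a, 'b) tensor \<Rightarrow> ('a, 'b) tensor" is "(+)"
  by (rule tensor_add)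
lift_definition uminus_tensor :: "('a, 'b) tensor \<Rightarrow> ('a, 'b) tensor" is "\<lambda>x. (-1) *\<^sub>C x"
  by (rule tensor_scale)
lift_definition minus_tensor :: "('a, 'b) tensor \<Rightarrow> ('a, 'b) tensor \<Rightarrow> ('a, 'b) tensor"
  is "\<lambda>x y. x + (-1) *\<^sub>C y"
  by (intro tensor_add tensor_scale)
lift_definition scaleC_tensor :: "complex \<Rightarrow> ('a, 'b) tensor \<Rightarrow> ('a, 'b) tensor" is scaleC
  by (rule tensor_scale)
instance
proof
  fix a b c :: "('a, 'b) tensor" and r s :: complex
  show "a + b + c = a + (b + c)" by transfer (simp add: add.assoc tensor_refl)
  show "a + b = b + a" by transfer (simp add: add.commute tensor_refl)
  show "0 + a = a" by transfer (simp add: tensor_refl)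
  show "- a + a = 0" by transfer (simp add: tensor_refl)
  show "a - b = a + - b" by transfer (simp add: tensor_refl)
  show "r *\<^sub>C (a + b) = r *\<^sub>C a + r *\<^sub>C b" by transfer (simp add: scaleC_add_right tensor_refl)
  show "(r + s) *\<^sub>C a = r *\<^sub>C a + s *\<^sub>C a" by transfer (simp add: scaleC_add_left tensor_refl)
  show "r *\<^sub>C s *\<^sub>C a = (r * s) *\<^sub>C a" by transfer (simp add: scaleC_scaleC tensor_refl)
  show "1 *\<^sub>C a = a" by transfer (simp add: scaleC_one tensor_refl)
qed
end

lift_definition tens :: "'p::complex_vector \<Rightarrow> 'v::complex_vector \<Rightarrow> ('p, 'v) tensor" (infixl \<open>\<otimes>\<^sub>C\<close> 70)
  is "\<lambda>p v. Poly_Mapping.single (p, v) 1" .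

lemma cbilinear_tens: "cbilinear (\<otimes>\<^sub>C)"
  unfolding cbilinear_def clinear_iff
  by (intro conjI allI; transfer;
      rule tensor_add_left tensor_add_right tensor_scale_left tensor_scale_right)

text \<open>\<open>tensor_lift b\<close> is the linear map \<open>p \<otimes> v \<mapsto> b p v\<close> given by the universal property,
  which is \<open>tensor_lift_unique\<close> below. It is meaningful only for bilinear \<open>b\<close>.\<close>

definition tensor_lift :: "('p::complex_vector \<Rightarrow> 'v::complex_vector \<Rightarrow> 'w::complex_vector)
    \<Rightarrow> ('p, 'v) tensor \<Rightarrow> 'w" where
  "tensor_lift b = (THE L. clinear L \<and> (\<forall>p v. L (p \<otimes>\<^sub>C v) = b p v))"

lemma lin_ext_tensor_rel:
  assumes "cbilinear b" "tensor_rel x y"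
  shows "lin_ext (\<lambda>(p, v). b p v) x = lin_ext (\<lambda>(p, v). b p v) y"
  using assms(2,1)
  by (induction rule: tensor_rel.induct)
    (simp_all add: lin_ext_add lin_ext_scaleC cbilinear_def clinear_iff scaleC_one
      del: scaleC_single)

lemma poly_mapping_lin_induct [case_names single add]:
  fixes z :: "'k \<Rightarrow>\<^sub>0 complex"
  assumes "\<And>k c. Q (Poly_Mapping.single k c)" "\<And>x y. Q x \<Longrightarrow> Q y \<Longrightarrow> Q (x + y)"
  shows "Q z"
proof -
  have "finite K \<Longrightarrow> Q (\<Sum>k\<in>K. Poly_Mapping.single k (Poly_Mapping.lookup z k))" for K
  proof (induction K rule: finite_induct)
    case empty
    show ?case using assms(1)[of undefined 0] by simp
  qed (simp add: assms)
  moreover have "(\<Sum>k\<in>Poly_Mapping.keys z. Poly_Mapping.single k (Poly_Mapping.lookup z k)) = z"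
    by (rule poly_mapping_eqI) (auto simp: lookup_sum lookup_single when_def in_keys_iff)
  ultimately show ?thesis using finite_keys[of z] by metis
qed

lemma tensor_induct [case_names tens add]:
  assumes "\<And>p v. Q (p \<otimes>\<^sub>C v)" "\<And>x y. Q x \<Longrightarrow> Q y \<Longrightarrow> Q (x + y)"
  shows "Q (z :: ('p::complex_vector, 'v::complex_vector) tensor)"
proof -
  have "Q (abs_tensor x)" for x :: "'p \<times> 'v \<Rightarrow>\<^sub>0 complex"
  proof (induction x rule: poly_mapping_lin_induct)
    case (single k c)
    obtain p v where k: "k = (p, v)" by force
    have "tensor_rel (Poly_Mapping.single (c *\<^sub>C p, v) 1) (Poly_Mapping.single (p, v) c)"
      using tensor_scale_left[of c p v]
      by (simp add: scaleC_complex_def)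
    then have "(c *\<^sub>C p) \<otimes>\<^sub>C v = abs_tensor (Poly_Mapping.single k c)"
      unfolding k tens.abs_eq tensor.abs_eq_iff .
    with assms(1) show ?case by metis
  next
    case (add x y)
    then show ?case using assms(2) by (simp flip: plus_tensor.abs_eq)
  qed
  then show ?thesis by (induction z rule: tensor.abs_induct) auto
qed

lemma tensor_lift_unique:
  assumes "cbilinear b"
  shows "\<exists>!L. clinear L \<and> (\<forall>p v. L (p \<otimes>\<^sub>C v) = b p v)"
proof -
  let ?e = "lin_ext (\<lambda>(p, v). b p v)"
  define L where "L t = ?e (rep_tensor t)" for t
  have L: "L (abs_tensor x) = ?e x" for x
    unfolding L_def
    by (rule lin_ext_tensor_rel[OF assms])
      (simp add: Quotient3_rep_abs[OF Quotient3_tensor] tensor_refl)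
  have lin: "L (s + t) = L s + L t" "L (c *\<^sub>C t) = c *\<^sub>C L t" for s t c
    by (induction s rule: tensor.abs_induct, induction t rule: tensor.abs_induct,
        simp add: plus_tensor.abs_eq scaleC_tensor.abs_eq L lin_ext_add lin_ext_scaleC)+
  have tens: "L (p \<otimes>\<^sub>C v) = b p v" for p v
    by (simp add: tens.abs_eq L scaleC_one)
  show ?thesis
  proof (rule ex1I[of _ L])
    show "clinear L \<and> (\<forall>p v. L (p \<otimes>\<^sub>C v) = b p v)" by (simp add: clinear_iff lin tens)
    fix M assume M: "clinear M \<and> (\<forall>p v. M (p \<otimes>\<^sub>C v) = b p v)"
    show "M = L"
    proof
      fix t show "M t = L t"
        by (induction t rule: tensor_induct) (use M in \<open>simp_all add: clinear_iff lin tens\<close>)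
    qed
  qed
qed

lemma
  assumes "cbilinear b"
  shows clinear_tensor_lift: "clinear (tensor_lift b)"
    and tensor_lift_tens [simp]: "tensor_lift b (p \<otimes>\<^sub>C v) = b p v"
  using theI'[OF tensor_lift_unique[OF assms]] by (auto simp: tensor_lift_def)

section \<open>The algebra \<open>A\<^sub>n\<close> and its derivations\<close>

text \<open>The indices \<open>1, \<dots>, n\<close> are the elements of a finite linearly ordered type \<open>'n\<close>,
  with \<open>n = CARD('n)\<close>. The monomial \<open>t\<^sup>a x\<^sup>b\<close> is the pair \<open>(a, b)\<close>; multiplication in
  \<open>_ \<Rightarrow>\<^sub>0 complex\<close> is convolution.\<close>

type_synonym 'n A = "('n \<Rightarrow>\<^sub>0 int) \<times> ('n \<Rightarrow>\<^sub>0 nat) \<Rightarrow>\<^sub>0 complex"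

definition t_deriv :: "'n \<Rightarrow> 'n A \<Rightarrow> 'n A" where \<comment> \<open>\<open>t\<^sub>i \<partial>/\<partial>t\<^sub>i\<close>\<close>
  "t_deriv i = lin_ext (\<lambda>(a, b). Poly_Mapping.single (a, b) (of_int (Poly_Mapping.lookup a i)))"

definition x_deriv :: "'n \<Rightarrow> 'n A \<Rightarrow> 'n A" where \<comment> \<open>\<open>\<partial>/\<partial>x\<^sub>i\<close>\<close>
  "x_deriv i = lin_ext (\<lambda>(a, b). Poly_Mapping.single (a, b - Poly_Mapping.single i 1)
     (of_nat (Poly_Mapping.lookup b i)))"

definition dA :: "'n \<Rightarrow> 'n A \<Rightarrow> 'n A" where
  "dA i f = t_deriv i f + x_deriv i f"

section \<open>The algebra \<open>D\<^sub>n\<close>\<close>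

text \<open>The free monoid on \<open>'g\<close>, written additively, so that
  \<open>'g free_monoid \<Rightarrow>\<^sub>0 complex\<close> is the free associative algebra on \<open>'g\<close>.\<close>

datatype 'g free_monoid = Letters "'g list"

instantiation free_monoid :: (type) monoid_add
begin
definition "0 = Letters []"
fun plus_free_monoid :: "'a free_monoid \<Rightarrow> 'a free_monoid \<Rightarrow> 'a free_monoid" where
  "Letters xs + Letters ys = Letters (xs @ ys)"
instance
proof
  fix a b c :: "'a free_monoid"
  show "a + b + c = a + (b + c)" by (cases a; cases b; cases c) simp
  show "0 + a = a" "a + 0 = a" by (cases a; simp add: zero_free_monoid_def)+
qed
end

datatype 'n D_gen = Gen_A "'n A" | Gen_d 'n

type_synonym 'n D_free = "'n D_gen free_monoid \<Rightarrow>\<^sub>0 complex"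

definition gen :: "'n D_gen \<Rightarrow> 'n D_free" where
  "gen g = Poly_Mapping.single (Letters [g]) 1"

text \<open>The smallest congruence for which \<open>Gen_A\<close> is a unital algebra homomorphism, the
  \<open>Gen_d i\<close> commute, and \<open>Gen_d i * Gen_A f - Gen_A f * Gen_d i = Gen_A (d\<^sub>i f)\<close>.\<close>

inductive D_rel :: "'n D_free \<Rightarrow> 'n D_free \<Rightarrow> bool" where
  D_refl: "D_rel x x"
| D_sym: "D_rel x y \<Longrightarrow> D_rel y x"
| D_trans: "D_rel x y \<Longrightarrow> D_rel y z \<Longrightarrow> D_rel x z"
| D_add: "D_rel x x' \<Longrightarrow> D_rel y y' \<Longrightarrow> D_rel (x + y) (x' + y')"
| D_mult: "D_rel x x' \<Longrightarrow> D_rel y y' \<Longrightarrow> D_rel (x * y) (x' * y')"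
| D_scale: "D_rel x x' \<Longrightarrow> D_rel (c *\<^sub>C x) (c *\<^sub>C x')"
| D_A_add: "D_rel (gen (Gen_A (f + g))) (gen (Gen_A f) + gen (Gen_A g))"
| D_A_scale: "D_rel (gen (Gen_A (c *\<^sub>C f))) (c *\<^sub>C gen (Gen_A f))"
| D_A_mult: "D_rel (gen (Gen_A (f * g))) (gen (Gen_A f) * gen (Gen_A g))"
| D_A_one: "D_rel (gen (Gen_A 1)) 1"
| D_d_comm: "D_rel (gen (Gen_d i) * gen (Gen_d j)) (gen (Gen_d j) * gen (Gen_d i))"
| D_d_A:
    "D_rel (gen (Gen_d i) * gen (Gen_A f) - gen (Gen_A f) * gen (Gen_d i)) (gen (Gen_A (dA i f)))"

quotient_type 'n D = "'n D_free" / D_rel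
  by (intro equivpI reflpI sympI transpI) (blast intro: D_refl D_sym D_trans)+

lemma mult_scaleC_free:
  fixes x y :: "'n D_free"
  shows "(c *\<^sub>C x) * y = c *\<^sub>C (x * y)"
    and "x * (c *\<^sub>C y) = c *\<^sub>C (x * y)"
proof -
  have s: "c *\<^sub>C z = Poly_Mapping.single 0 c * z" "c *\<^sub>C z = z * Poly_Mapping.single 0 c"
    for c and z :: "'n D_free"
    by (induction z rule: poly_mapping_lin_induct)
      (simp_all add: scaleC_single scaleC_complex_def mult_single scaleC_add_right
        distrib_left distrib_right mult.commute)
  show "(c *\<^sub>C x) * y = c *\<^sub>C (x * y)" by (simp add: s(1) mult.assoc)
  show "x * (c *\<^sub>C y) = c *\<^sub>C (x * y)" by (simp add: s(2) mult.assoc)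
qed

instantiation D :: (type) "{complex_vector, ring, monoid_mult}"
begin
lift_definition zero_D :: "'a D" is 0 .
lift_definition one_D :: "'a D" is 1 .
lift_definition plus_D :: "'a D \<Rightarrow> 'a D \<Rightarrow> 'a D" is "(+)" by (rule D_add)
lift_definition times_D :: "'a D \<Rightarrow> 'a D \<Rightarrow> 'a D" is "(*)" by (rule D_mult)
lift_definition uminus_D :: "'a D \<Rightarrow> 'a D" is "\<lambda>x. (-1) *\<^sub>C x" by (rule D_scale)
lift_definition minus_D :: "'a D \<Rightarrow> 'a D \<Rightarrow> 'a D" is "\<lambda>x y. x + (-1) *\<^sub>C y"
  by (intro D_add D_scale)
lift_definition scaleC_D :: "complex \<Rightarrow> 'a D \<Rightarrow> 'a D" is scaleC by (rule D_scale)
instance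
proof
  fix a b c :: "'a D" and r s :: complex
  show "a + b + c = a + (b + c)" by transfer (simp add: add.assoc D_refl)
  show "a + b = b + a" by transfer (simp add: add.commute D_refl)
  show "0 + a = a" by transfer (simp add: D_refl)
  show "- a + a = 0" by transfer (simp add: D_refl)
  show "a - b = a + - b" by transfer (simp add: D_refl)
  show "r *\<^sub>C (a + b) = r *\<^sub>C a + r *\<^sub>C b" by transfer (simp add: scaleC_add_right D_refl)
  show "(r + s) *\<^sub>C a = r *\<^sub>C a + s *\<^sub>C a" by transfer (simp add: scaleC_add_left D_refl)
  show "r *\<^sub>C s *\<^sub>C a = (r * s) *\<^sub>C a" by transfer (simp add: scaleC_scaleC D_refl)
  show "1 *\<^sub>C a = a" by transfer (simp add: scaleC_one D_refl)
  show "a * b * c = a * (b * c)" by transfer (simp add: mult.assoc D_refl)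
  show "(a + b) * c = a * c + b * c" by transfer (simp add: distrib_right D_refl)
  show "a * (b + c) = a * b + a * c" by transfer (simp add: distrib_left D_refl)
  show "1 * a = a" "a * 1 = a" by (transfer, simp add: D_refl)+
qed
end

lift_definition ofA :: "'n A \<Rightarrow> 'n D" is "\<lambda>f. gen (Gen_A f)" .
lift_definition dD :: "'n \<Rightarrow> 'n D" is "\<lambda>i. gen (Gen_d i)" .

lemma ofA_add: "ofA (f + g) = ofA f + ofA g"
  by transfer (rule D_A_add)
lemma ofA_scaleC: "ofA (c *\<^sub>C f) = c *\<^sub>C ofA f"
  by transfer (rule D_A_scale)
lemma ofA_mult: "ofA (f * g) = ofA f * ofA g"
  by transfer (rule D_A_mult)
lemma ofA_one: "ofA 1 = 1"
  by transfer (rule D_A_one)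
lemma dD_commute: "dD i * dD j = dD j * dD i"
  by transfer (rule D_d_comm)
lemma dD_ofA: "dD i * ofA f - ofA f * dD i = ofA (dA i f)"
proof (transfer, goal_cases)
  case (1 i f)
  have "x - y = x + (-1) *\<^sub>C y" for x y :: "'a D_free"
    by (simp add: complex_vector.scale_minus_left scaleC_one)
  then show ?case using D_d_A[of i f] by simp
qed
lemma D_scaleC_mult:
  fixes x y :: "'n D"
  shows "(c *\<^sub>C x) * y = c *\<^sub>C (x * y)" "x * (c *\<^sub>C y) = c *\<^sub>C (x * y)"
  by (transfer, simp add: mult_scaleC_free D_refl)+

section \<open>Modules\<close>

definition algebra_module ::
  "('a::{complex_vector, ring, monoid_mult} \<Rightarrow> 'm::complex_vector \<Rightarrow> 'm) \<Rightarrow> bool" where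
  "algebra_module act \<longleftrightarrow> cbilinear act \<and> (\<forall>m. act 1 m = m) \<and>
     (\<forall>x y m. act (x * y) m = act x (act y m))"

definition lie_module ::
  "('l::complex_vector \<Rightarrow> 'l \<Rightarrow> 'l) \<Rightarrow> ('l \<Rightarrow> 'm::complex_vector \<Rightarrow> 'm) \<Rightarrow> bool" where
  "lie_module bracket act \<longleftrightarrow> cbilinear act \<and>
     (\<forall>x y m. act (bracket x y) m = act x (act y m) - act y (act x m))"

text \<open>Submodules under the elements of \<open>S\<close>, a subset of the acting algebra:
  \<open>S = UNIV\<close>, except for the restriction of a module to a Lie subalgebra \<open>S\<close>.\<close>

definition submodule :: "'a set \<Rightarrow> ('a \<Rightarrow> 'm::complex_vector \<Rightarrow> 'm) \<Rightarrow> 'm set \<Rightarrow> bool" where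
  "submodule S act U \<longleftrightarrow> complex_vector.subspace U \<and> (\<forall>x\<in>S. \<forall>u\<in>U. act x u \<in> U)"

definition reducible_module :: "'a set \<Rightarrow> ('a \<Rightarrow> 'm::complex_vector \<Rightarrow> 'm) \<Rightarrow> bool" where
  "reducible_module S act \<longleftrightarrow> (\<exists>U. submodule S act U \<and> U \<noteq> {0} \<and> U \<noteq> UNIV)"

definition simple_module :: "'a set \<Rightarrow> ('a \<Rightarrow> 'm::complex_vector \<Rightarrow> 'm) \<Rightarrow> bool" where
  "simple_module S act \<longleftrightarrow> (UNIV :: 'm set) \<noteq> {0} \<and>
     (\<forall>U. submodule S act U \<longrightarrow> U = {0} \<or> U = UNIV)"

section \<open>\<open>\<gg>\<ll>\<^sub>n\<close> and the modules \<open>V(\<delta>\<^sub>r, r)\<close>\<close>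

type_synonym 'n gl = "complex^'n^'n"

definition gl_bracket :: "'n::finite gl \<Rightarrow> 'n gl \<Rightarrow> 'n gl" where
  "gl_bracket X Y = X ** Y - Y ** X"

definition matrix_unit :: "'n::finite \<Rightarrow> 'n \<Rightarrow> 'n gl" where
  "matrix_unit i j = (\<chi> k l. if k = i \<and> l = j then 1 else 0)"

definition sl :: "'n::finite gl set" where
  "sl = {X. trace X = 0}"

text \<open>\<open>nth_index j\<close> is the \<open>j\<close>-th smallest element of \<open>'n\<close>, \<open>1 \<le> j \<le> n\<close>.\<close>

definition nth_index :: "nat \<Rightarrow> 'n::{finite, linorder}" where
  "nth_index j = sorted_list_of_set UNIV ! (j - 1)"

text \<open>\<open>coroot j\<close> is \<open>E\<^sub>j\<^sub>,\<^sub>j - E\<^sub>j\<^sub>+\<^sub>1\<^sub>,\<^sub>j\<^sub>+\<^sub>1\<close>. A weight of \<open>\<ss>\<ll>\<^sub>n\<close> is given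
  by its values on \<open>coroot 1, \<dots>, coroot (n - 1)\<close>, which form a basis of the Cartan subalgebra.\<close>

definition coroot :: "nat \<Rightarrow> 'n::{finite, linorder} gl" where
  "coroot j = matrix_unit (nth_index j) (nth_index j)
     - matrix_unit (nth_index (j + 1)) (nth_index (j + 1))"

definition highest_weight_vector ::
  "(nat \<Rightarrow> complex) \<Rightarrow> ('n::{finite, linorder} gl \<Rightarrow> 'v::complex_vector \<Rightarrow> 'v) \<Rightarrow> 'v \<Rightarrow> bool" where
  "highest_weight_vector w act v \<longleftrightarrow> v \<noteq> 0 \<and> (\<forall>i j. i < j \<longrightarrow> act (matrix_unit i j) v = 0) \<and>
     (\<forall>j\<in>{1..<CARD('n)}. act (coroot j) v = w j *\<^sub>C v)"

text \<open>A simple module with a highest weight vector is generated by it, so it is a highest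
  weight module.\<close>

definition sl_simple_highest_weight ::
  "(nat \<Rightarrow> complex) \<Rightarrow> ('n::{finite, linorder} gl \<Rightarrow> 'v::complex_vector \<Rightarrow> 'v) \<Rightarrow> bool" where
  "sl_simple_highest_weight w act \<longleftrightarrow>
     simple_module sl act \<and> (\<exists>v. highest_weight_vector w act v)"

definition delta_weight :: "nat \<Rightarrow> nat \<Rightarrow> complex" where
  "delta_weight r j = (if r = j then 1 else 0)"

text \<open>The properties defining \<open>V(\<delta>\<^sub>r, r)\<close> determine it up to isomorphism and are invariant
  under isomorphism; so \<open>V \<cong> V(\<delta>\<^sub>r, r)\<close> means that \<open>V\<close> has them.\<close>

definition iso_V_delta :: "nat \<Rightarrow> ('n::{finite, linorder} gl \<Rightarrow> 'v::complex_vector \<Rightarrow> 'v) \<Rightarrow> bool" where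
  "iso_V_delta r act \<longleftrightarrow>
     lie_module gl_bracket act \<and> simple_module UNIV act \<and>
     (\<forall>v. act (mat 1) v = of_nat r *\<^sub>C v) \<and>
     sl_simple_highest_weight (delta_weight r) act"

section \<open>\<open>\<gg>\<^sub>n\<close> and the modules \<open>T(P, V)\<close>\<close>

text \<open>\<open>X\<close> stands for \<open>\<Sum>\<^sub>j (X $ j) d\<^sub>j\<close>.\<close>

type_synonym 'n g = "('n A)^'n"

definition g_bracket :: "'n::finite g \<Rightarrow> 'n g \<Rightarrow> 'n g" where
  "g_bracket X Y = (\<chi> k. \<Sum>i\<in>UNIV. X $ i * dA i (Y $ k) - Y $ i * dA i (X $ k))"

definition T_act :: "('n::finite D \<Rightarrow> 'p::complex_vector \<Rightarrow> 'p) \<Rightarrow>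
    ('n gl \<Rightarrow> 'v::complex_vector \<Rightarrow> 'v) \<Rightarrow> 'n g \<Rightarrow> ('p, 'v) tensor \<Rightarrow> ('p, 'v) tensor" where
  "T_act actP actV X = tensor_lift (\<lambda>p v. \<Sum>j\<in>UNIV.
     actP (ofA (X $ j) * dD j) p \<otimes>\<^sub>C v
       + (\<Sum>i\<in>UNIV. actP (ofA (dA i (X $ j))) p \<otimes>\<^sub>C actV (matrix_unit i j) v))"

section \<open>\<open>T(P, V)\<close> is a \<open>\<gg>\<^sub>n\<close>-module\<close>

lemma dA_single:
  "dA i (Poly_Mapping.single (a, b) c) =
     Poly_Mapping.single (a, b) (c * of_int (Poly_Mapping.lookup a i))
     + Poly_Mapping.single (a, b - Poly_Mapping.single i 1) (c * of_nat (Poly_Mapping.lookup b i))"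
  by (simp add: dA_def t_deriv_def x_deriv_def scaleC_complex_def)

lemma clinear_dA: "clinear (dA i)"
  by (simp add: clinear_iff dA_def t_deriv_def x_deriv_def lin_ext_add lin_ext_scaleC
      scaleC_add_right del: scaleC_single)

lemmas dA_add = clinear_dA[unfolded clinear_iff, THEN conjunct1, rule_format]

lemma minus_single_add:
  fixes b b' :: "'n \<Rightarrow>\<^sub>0 nat"
  assumes "Poly_Mapping.lookup b i \<noteq> 0"
  shows "b - Poly_Mapping.single i 1 + b' = b + b' - Poly_Mapping.single i 1"
  using assms by (auto intro!: poly_mapping_eqI simp: lookup_add lookup_minus lookup_single when_def)

lemma dA_mult: "dA i (f * g) = dA i f * g + f * dA i g"
proof (induction f rule: poly_mapping_lin_induct)
  case (single k c)
  obtain a b where k: "k = (a, b)" by force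
  show ?case
  proof (induction g rule: poly_mapping_lin_induct)
    case (single k' c')
    obtain a' b' where k': "k' = (a', b')" by force
    have 1: "Poly_Mapping.single (a + a', b - Poly_Mapping.single i 1 + b') (c * of_nat (Poly_Mapping.lookup b i) * c')
      = Poly_Mapping.single (a + a', b + b' - Poly_Mapping.single i 1) (c * of_nat (Poly_Mapping.lookup b i) * c')"
      by (cases "Poly_Mapping.lookup b i = 0") (use minus_single_add[of b i b'] in auto)
    have 2: "Poly_Mapping.single (a + a', b + (b' - Poly_Mapping.single i 1)) (c * (c' * of_nat (Poly_Mapping.lookup b' i)))
      = Poly_Mapping.single (a + a', b + b' - Poly_Mapping.single i 1) (c * (c' * of_nat (Poly_Mapping.lookup b' i)))"
      by (cases "Poly_Mapping.lookup b' i = 0") (use minus_single_add[of b' i b] in \<open>auto simp: add.commute\<close>)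
    show ?case
      unfolding k k'
      apply (simp only: mult_single dA_single distrib_left distrib_right plus_prod_def fst_conv snd_conv 1 2)
      by (simp add: lookup_add algebra_simps single_add)
  next
    case (add x y)
    then show ?case by (simp add: dA_add algebra_simps)
  qed
next
  case (add x y)
  then show ?case by (simp add: dA_add algebra_simps)
qed

lemma dA_commute: "dA i (dA j f) = dA j (dA i f)"
proof (induction f rule: poly_mapping_lin_induct)
  case (single k c)
  obtain a b where k: "k = (a, b)" by force
  show ?case
  proof (cases "i = j")
    case False
    then show ?thesis
      unfolding k by (simp add: dA_add dA_single lookup_minus lookup_single diff_right_commute algebra_simps)
  qed simp
next
  case (add x y)
  then show ?case by (simp add: dA_add)
qed

lemma dA_t: "dA i (Poly_Mapping.single (Poly_Mapping.single j 1, 0) 1) =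
    (if i = j then Poly_Mapping.single (Poly_Mapping.single j 1, 0) 1 else 0)"
  by (simp add: dA_single lookup_single when_def)

lemma dA_x: "dA i (Poly_Mapping.single (0, Poly_Mapping.single j 1) 1) = (if i = j then 1 else 0)"
  by (simp add: dA_single lookup_single when_def flip: zero_prod_def)

lemma additive_sum_diff: fixes h :: "'a::ab_group_add \<Rightarrow> 'b::ab_group_add" assumes "\<And>x y. h (x + y) = h x + h y"
  shows "h (sum f S) = (\<Sum>i\<in>S. h (f i))" "h (x - y) = h x - h y"
proof -
  interpret Modules.additive h by standard (rule assms)
  show "h (sum f S) = (\<Sum>i\<in>S. h (f i))" "h (x - y) = h x - h y" by (rule sum, rule diff)
qed

lemmas dA_sum = additive_sum_diff[of "dA i" for i, OF dA_add]
lemmas ofA_sum = additive_sum_diff[of ofA, OF ofA_add]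

lemma d_move: "dD i * ofA f = ofA f * dD i + ofA (dA i f)"
  using dD_ofA[of i f] by (simp add: algebra_simps)

definition vf :: "'n::finite g \<Rightarrow> 'n D" where \<comment> \<open>the vector field \<open>X\<close> as an element of \<open>D\<^sub>n\<close>\<close>
  "vf X = (\<Sum>j\<in>UNIV. ofA (X $ j) * dD j)"

lemma vf_ofA: "vf X * ofA f = ofA f * vf X + (\<Sum>j\<in>UNIV. ofA (X $ j * dA j f))"
proof -
  have *: "ofA (X $ j) * ofA f = ofA f * ofA (X $ j)" for j
    by (metis ofA_mult mult.commute)
  have "ofA (X $ j) * dD j * ofA f = ofA f * (ofA (X $ j) * dD j) + ofA (X $ j * dA j f)" for j
    by (simp add: mult.assoc d_move distrib_left ofA_mult) (simp add: * flip: mult.assoc)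
  then show ?thesis by (simp add: vf_def sum_distrib_left sum_distrib_right sum.distrib)
qed

lemma vf_dD: "vf X * dD k = (\<Sum>j\<in>UNIV. ofA (X $ j) * (dD j * dD k))"
  by (simp add: vf_def sum_distrib_right mult.assoc)

lemma vf_vf: "vf X * vf Y = (\<Sum>k\<in>UNIV. \<Sum>j\<in>UNIV. ofA (X $ j * dA j (Y $ k)) * dD k)
   + (\<Sum>k\<in>UNIV. \<Sum>j\<in>UNIV. ofA (X $ j * Y $ k) * (dD j * dD k))"
proof -
  have "vf X * vf Y = (\<Sum>k\<in>UNIV. vf X * ofA (Y $ k) * dD k)"
    by (simp add: vf_def[of Y] sum_distrib_left mult.assoc)
  also have "\<dots> = (\<Sum>k\<in>UNIV. (\<Sum>j\<in>UNIV. ofA (X $ j * dA j (Y $ k)) * dD k)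
     + (\<Sum>j\<in>UNIV. ofA (X $ j * Y $ k) * (dD j * dD k)))"
  proof (rule sum.cong[OF refl])
    fix k
    show "vf X * ofA (Y $ k) * dD k = (\<Sum>j\<in>UNIV. ofA (X $ j * dA j (Y $ k)) * dD k)
     + (\<Sum>j\<in>UNIV. ofA (X $ j * Y $ k) * (dD j * dD k))"
      unfolding vf_ofA distrib_right mult.assoc vf_dD
      by (simp add: sum_distrib_left sum_distrib_right ofA_mult[symmetric] mult.assoc[symmetric] mult.commute[of "Y $ k"])
  qed
  finally show ?thesis by (simp add: sum.distrib)
qed

lemma vf_bracket: "vf X * vf Y - vf Y * vf X = vf (g_bracket X Y)"
proof -
  have "(\<Sum>k\<in>UNIV. \<Sum>j\<in>UNIV. ofA (X $ j * Y $ k) * (dD j * dD k)) = 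
     (\<Sum>k\<in>UNIV. \<Sum>j\<in>UNIV. ofA (Y $ j * X $ k) * (dD j * dD k))"
    by (subst sum.swap) (simp add: mult.commute dD_commute)
  then have "vf X * vf Y - vf Y * vf X = (\<Sum>k\<in>UNIV. \<Sum>j\<in>UNIV. ofA (X $ j * dA j (Y $ k)) * dD k)
     - (\<Sum>k\<in>UNIV. \<Sum>j\<in>UNIV. ofA (Y $ j * dA j (X $ k)) * dD k)"
    unfolding vf_vf by simp
  also have "\<dots> = vf (g_bracket X Y)"
    by (simp add: vf_def g_bracket_def ofA_sum sum_distrib_right left_diff_distrib sum_subtractf)
  finally show ?thesis .
qed

lemma dA_bracket: "dA i (g_bracket X Y $ l) = 
   (\<Sum>k\<in>UNIV. dA i (X $ k) * dA k (Y $ l)) - (\<Sum>k\<in>UNIV. dA i (Y $ k) * dA k (X $ l))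
  + (\<Sum>k\<in>UNIV. X $ k * dA k (dA i (Y $ l))) - (\<Sum>k\<in>UNIV. Y $ k * dA k (dA i (X $ l)))"
  by (simp add: g_bracket_def dA_sum dA_mult sum_subtractf sum.distrib dA_commute[of i])

lemma matrix_unit_mult: "matrix_unit i j ** matrix_unit k l = (if j = k then matrix_unit i l else 0)"
proof (simp add: vec_eq_iff matrix_unit_def matrix_matrix_mult_def, intro allI conjI impI)
qed (auto simp: if_distrib[of "\<lambda>x. _ * x"] sum.delta cong: if_cong intro!: sum.neutral)


lemma abs_arith: fixes A :: "'z::ab_group_add"
  assumes "R = (C - D) + M - N" "w0 = w1 - w2" "A - B = C - D"
  shows "w0 + R = (w1 + r1 + r2 + M + A) - (w2 + r2 + r1 + N + B)"
proof -
  have A: "A = B + C - D" using assms(3) by (simp add: algebra_simps)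
  show ?thesis unfolding A assms(1,2) by (simp add: algebra_simps)
qed

lemma tens_lin:
  "(x + y) \<otimes>\<^sub>C v = x \<otimes>\<^sub>C v + y \<otimes>\<^sub>C v" "p \<otimes>\<^sub>C (a + b) = p \<otimes>\<^sub>C a + p \<otimes>\<^sub>C b"
  "(c *\<^sub>C x) \<otimes>\<^sub>C v = c *\<^sub>C (x \<otimes>\<^sub>C v)" "p \<otimes>\<^sub>C (c *\<^sub>C a) = c *\<^sub>C (p \<otimes>\<^sub>C a)"
  using cbilinear_tens unfolding cbilinear_def clinear_iff by blast+

lemmas tensL = additive_sum_diff[of "\<lambda>x. x \<otimes>\<^sub>C v" for v, OF tens_lin(1)]
lemmas tensR = additive_sum_diff[of "\<lambda>x. p \<otimes>\<^sub>C x" for p, OF tens_lin(2)]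

context
  fixes actP :: "'n::finite D \<Rightarrow> 'p::complex_vector \<Rightarrow> 'p"
    and actV :: "'n gl \<Rightarrow> 'v::complex_vector \<Rightarrow> 'v"
  assumes P: "algebra_module actP" and V: "lie_module gl_bracket actV"
begin

private lemma P_lin: "actP (x + y) p = actP x p + actP y p" "actP x (p + q) = actP x p + actP x q"
  "actP (c *\<^sub>C x) p = c *\<^sub>C actP x p" "actP x (c *\<^sub>C p) = c *\<^sub>C actP x p" 
  "actP (x * y) p = actP x (actP y p)"
  using P unfolding algebra_module_def cbilinear_def clinear_iff by blast+
private lemma V_lin: "actV (x + y) v = actV x v + actV y v" "actV x (v + u) = actV x v + actV x u"
  "actV (c *\<^sub>C x) v = c *\<^sub>C actV x v" "actV x (c *\<^sub>C v) = c *\<^sub>C actV x v" 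
  "actV (gl_bracket x y) v = actV x (actV y v) - actV y (actV x v)"
  using V unfolding lie_module_def cbilinear_def clinear_iff by blast+
private lemmas P_sum = additive_sum_diff[of "\<lambda>x. actP x p" for p, OF P_lin(1)]
private lemmas P_sum' = additive_sum_diff[of "actP x" for x, OF P_lin(2)]
private lemmas V_sum = additive_sum_diff[of "\<lambda>x. actV x p" for p, OF V_lin(1)]

private abbreviation "R X p v \<equiv> (\<Sum>j\<in>UNIV. \<Sum>i\<in>UNIV. actP (ofA (dA i (X $ j))) p \<otimes>\<^sub>C actV (matrix_unit i j) v)"
private abbreviation "b X p v \<equiv> (\<Sum>j\<in>UNIV. actP (ofA (X $ j) * dD j) p \<otimes>\<^sub>C v
       + (\<Sum>i\<in>UNIV. actP (ofA (dA i (X $ j))) p \<otimes>\<^sub>C actV (matrix_unit i j) v))"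

private lemma cb: "cbilinear (b X)"
  unfolding cbilinear_def clinear_iff
  by (simp add: P_lin V_lin tens_lin sum.distrib complex_vector.scale_sum_right scaleC_add_right)

private lemma T_tens: "T_act actP actV X (p \<otimes>\<^sub>C v) = actP (vf X) p \<otimes>\<^sub>C v + R X p v"
  unfolding T_act_def tensor_lift_tens[OF cb]
  by (simp add: sum.distrib vf_def P_sum tensL)

private lemma T_lin: "T_act actP actV X (s + t) = T_act actP actV X s + T_act actP actV X t"
   "T_act actP actV X (c *\<^sub>C s) = c *\<^sub>C T_act actP actV X s"
  using clinear_tensor_lift[OF cb[of X]] unfolding clinear_iff T_act_def by blast+

private lemma T_linX: "T_act actP actV (X + Y) t = T_act actP actV X t + T_act actP actV Y t"
  "T_act actP actV (c *\<^sub>C X) t = c *\<^sub>C T_act actP actV X t"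
proof (induction t rule: tensor_induct)
  case (tens p v)
  have dAs: "dA i (c *\<^sub>C f) = c *\<^sub>C dA i f" for c i and f :: "'n A"
    using clinear_dA[of i] unfolding clinear_iff by blast
  case 1 show ?case by (simp add: T_tens vf_def P_lin tens_lin sum.distrib P_sum dA_add ofA_add tensL distrib_right)
  case 2 show ?case by (simp add: T_tens vf_def P_lin tens_lin sum.distrib P_sum dAs ofA_scaleC tensL scaleC_vec_def D_scaleC_mult complex_vector.scale_sum_right scaleC_add_right)
next
  case (add x y)
  case 1 from add show ?case by (simp add: T_lin)
  case 2 from add show ?case by (simp add: T_lin scaleC_add_right)
qed

private lemmas T_sum = additive_sum_diff[of "T_act actP actV X" for X, OF T_lin(1)]

private lemma TT: "T_act actP actV X (T_act actP actV Y (p \<otimes>\<^sub>C v)) =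
   actP (vf X) (actP (vf Y) p) \<otimes>\<^sub>C v + R X (actP (vf Y) p) v
   + R Y (actP (vf X) p) v
   + (\<Sum>l\<in>UNIV. \<Sum>k\<in>UNIV. actP (\<Sum>m\<in>UNIV. ofA (X $ m * dA m (dA k (Y $ l)))) p \<otimes>\<^sub>C actV (matrix_unit k l) v)
   + (\<Sum>l\<in>UNIV. \<Sum>k\<in>UNIV. \<Sum>j\<in>UNIV. \<Sum>i\<in>UNIV. actP (ofA (dA i (X $ j) * dA k (Y $ l))) p \<otimes>\<^sub>C actV (matrix_unit i j) (actV (matrix_unit k l) v))"
proof -
  have "actP (vf X) (actP (ofA f) p) = actP (ofA f) (actP (vf X) p) + actP (\<Sum>m\<in>UNIV. ofA (X $ m * dA m f)) p" for f
    unfolding P_lin(5)[symmetric] P_lin(1)[symmetric] vf_ofA ..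
  note * = this
  show ?thesis
    unfolding T_tens[of Y] T_lin T_tens T_sum * tens_lin(1) sum.distrib ofA_mult P_lin(5)
    by (simp only: ac_simps)
qed

private lemma EE: "actV (matrix_unit i j) (actV (matrix_unit k l) v) - actV (matrix_unit k l) (actV (matrix_unit i j) v)
   = (if j = k then actV (matrix_unit i l) v else 0) - (if l = i then actV (matrix_unit k j) v else 0)"
proof -
  have z: "actV 0 v = 0" using V_lin(3)[of 0 0 v] by simp
  show ?thesis
  unfolding V_lin(5)[symmetric] gl_bracket_def matrix_unit_mult V_sum(2) using z by auto
qed

private lemma bilpart: "(\<Sum>l\<in>UNIV. \<Sum>k\<in>UNIV. \<Sum>j\<in>UNIV. \<Sum>i\<in>UNIV. actP (ofA (dA i (X $ j) * dA k (Y $ l))) p \<otimes>\<^sub>C actV (matrix_unit i j) (actV (matrix_unit k l) v))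
  - (\<Sum>l\<in>UNIV. \<Sum>k\<in>UNIV. \<Sum>j\<in>UNIV. \<Sum>i\<in>UNIV. actP (ofA (dA i (Y $ j) * dA k (X $ l))) p \<otimes>\<^sub>C actV (matrix_unit i j) (actV (matrix_unit k l) v))
  = (\<Sum>l\<in>UNIV. \<Sum>i\<in>UNIV. \<Sum>k\<in>UNIV. actP (ofA (dA i (X $ k) * dA k (Y $ l))) p \<otimes>\<^sub>C actV (matrix_unit i l) v)
  - (\<Sum>l\<in>UNIV. \<Sum>i\<in>UNIV. \<Sum>k\<in>UNIV. actP (ofA (dA i (Y $ k) * dA k (X $ l))) p \<otimes>\<^sub>C actV (matrix_unit i l) v)"
   (is "?A - ?B = ?C - ?D")
proof -
  let ?F = "\<lambda>i j k l. actP (ofA (dA i (X $ j) * dA k (Y $ l))) p"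
  have z: "x \<otimes>\<^sub>C 0 = 0" for x :: 'p using tens_lin(4)[of x 0 0] by simp
  have B: "?B = (\<Sum>l\<in>UNIV. \<Sum>k\<in>UNIV. \<Sum>j\<in>UNIV. \<Sum>i\<in>UNIV. ?F i j k l \<otimes>\<^sub>C actV (matrix_unit k l) (actV (matrix_unit i j) v))"
  proof -
    have sw: "(\<Sum>l\<in>UNIV. \<Sum>k\<in>UNIV. \<Sum>j\<in>UNIV. \<Sum>i\<in>UNIV. G l k j i) = (\<Sum>j\<in>UNIV. \<Sum>i\<in>UNIV. \<Sum>l\<in>UNIV. \<Sum>k\<in>UNIV. G l k j i)" for G :: "'n \<Rightarrow> 'n \<Rightarrow> 'n \<Rightarrow> 'n \<Rightarrow> ('p,'v) tensor"
    proof -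
      have "(\<Sum>k\<in>UNIV. \<Sum>j\<in>UNIV. \<Sum>i\<in>UNIV. G l k j i) = (\<Sum>j\<in>UNIV. \<Sum>i\<in>UNIV. \<Sum>k\<in>UNIV. G l k j i)" for l
        by (rule trans[OF sum.swap sum.cong[OF refl sum.swap]])
      then have "(\<Sum>l\<in>UNIV. \<Sum>k\<in>UNIV. \<Sum>j\<in>UNIV. \<Sum>i\<in>UNIV. G l k j i) = (\<Sum>l\<in>UNIV. \<Sum>j\<in>UNIV. \<Sum>i\<in>UNIV. \<Sum>k\<in>UNIV. G l k j i)" by presburger
      also have "\<dots> = (\<Sum>j\<in>UNIV. \<Sum>i\<in>UNIV. \<Sum>l\<in>UNIV. \<Sum>k\<in>UNIV. G l k j i)"
        by (rule trans[OF sum.swap sum.cong[OF refl sum.swap]])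
      finally show ?thesis .
    qed
    show ?thesis unfolding sw[of "\<lambda>l k j i. actP (ofA (dA i (Y $ j) * dA k (X $ l))) p \<otimes>\<^sub>C actV (matrix_unit i j) (actV (matrix_unit k l) v)"] by (intro sum.cong refl arg_cong2[where f="(\<otimes>\<^sub>C)"] arg_cong[where f="\<lambda>x. actP (ofA x) p"] mult.commute)
  qed
  have e: "?F i j k l \<otimes>\<^sub>C actV (matrix_unit i j) (actV (matrix_unit k l) v) - ?F i j k l \<otimes>\<^sub>C actV (matrix_unit k l) (actV (matrix_unit i j) v)
     = (if j = k then ?F i j k l \<otimes>\<^sub>C actV (matrix_unit i l) v else 0) - (if l = i then ?F i j k l \<otimes>\<^sub>C actV (matrix_unit k j) v else 0)" for i j k l
    unfolding tensR(2)[symmetric] EE using z by (auto simp: tensR)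
  have "?A - ?B = (\<Sum>l\<in>UNIV. \<Sum>k\<in>UNIV. \<Sum>j\<in>UNIV. \<Sum>i\<in>UNIV. (if j = k then ?F i j k l \<otimes>\<^sub>C actV (matrix_unit i l) v else 0))
    - (\<Sum>l\<in>UNIV. \<Sum>k\<in>UNIV. \<Sum>j\<in>UNIV. \<Sum>i\<in>UNIV. (if l = i then ?F i j k l \<otimes>\<^sub>C actV (matrix_unit k j) v else 0))" (is "_ = ?C' - ?D'")
    unfolding B sum_subtractf[symmetric] e ..
  also have "?C' = ?C"
  proof (rule sum.cong[OF refl])
    fix l
    have "(\<Sum>k\<in>UNIV. \<Sum>j\<in>UNIV. \<Sum>i\<in>UNIV. (if j = k then ?F i j k l \<otimes>\<^sub>C actV (matrix_unit i l) v else 0))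
      = (\<Sum>k\<in>UNIV. \<Sum>i\<in>UNIV. \<Sum>j\<in>UNIV. (if j = k then ?F i j k l \<otimes>\<^sub>C actV (matrix_unit i l) v else 0))"
      by (rule sum.cong[OF refl sum.swap])
    also have "\<dots> = (\<Sum>k\<in>UNIV. \<Sum>i\<in>UNIV. ?F i k k l \<otimes>\<^sub>C actV (matrix_unit i l) v)" by simp
    also have "\<dots> = (\<Sum>i\<in>UNIV. \<Sum>k\<in>UNIV. ?F i k k l \<otimes>\<^sub>C actV (matrix_unit i l) v)" by (rule sum.swap)
    finally show "(\<Sum>k\<in>UNIV. \<Sum>j\<in>UNIV. \<Sum>i\<in>UNIV. (if j = k then ?F i j k l \<otimes>\<^sub>C actV (matrix_unit i l) v else 0)) = (\<Sum>i\<in>UNIV. \<Sum>k\<in>UNIV. ?F i k k l \<otimes>\<^sub>C actV (matrix_unit i l) v)" .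
  qed
  also have "?D' = ?D"
  proof -
    have "?D' = (\<Sum>l\<in>UNIV. \<Sum>k\<in>UNIV. \<Sum>j\<in>UNIV. ?F l j k l \<otimes>\<^sub>C actV (matrix_unit k j) v)" by simp
    also have "\<dots> = (\<Sum>l\<in>UNIV. \<Sum>j\<in>UNIV. \<Sum>k\<in>UNIV. ?F l j k l \<otimes>\<^sub>C actV (matrix_unit k j) v)" by (rule sum.cong[OF refl sum.swap])
    also have "\<dots> = (\<Sum>j\<in>UNIV. \<Sum>l\<in>UNIV. \<Sum>k\<in>UNIV. ?F l j k l \<otimes>\<^sub>C actV (matrix_unit k j) v)" by (rule sum.swap)
    also have "\<dots> = (\<Sum>j\<in>UNIV. \<Sum>k\<in>UNIV. \<Sum>l\<in>UNIV. ?F l j k l \<otimes>\<^sub>C actV (matrix_unit k j) v)" by (rule sum.cong[OF refl sum.swap])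
    also have "\<dots> = ?D" by (intro sum.cong refl arg_cong2[where f="(\<otimes>\<^sub>C)"] arg_cong[where f="\<lambda>x. actP (ofA x) p"] mult.commute)
    finally show ?thesis .
  qed
  finally show ?thesis .
qed

private lemma T_lie: "T_act actP actV (g_bracket X Y) t = T_act actP actV X (T_act actP actV Y t) - T_act actP actV Y (T_act actP actV X t)"
proof (induction t rule: tensor_induct)
  case (tens p v)
  have "R (g_bracket X Y) p v = 
    ((\<Sum>l\<in>UNIV. \<Sum>i\<in>UNIV. \<Sum>k\<in>UNIV. actP (ofA (dA i (X $ k) * dA k (Y $ l))) p \<otimes>\<^sub>C actV (matrix_unit i l) v)
  - (\<Sum>l\<in>UNIV. \<Sum>i\<in>UNIV. \<Sum>k\<in>UNIV. actP (ofA (dA i (Y $ k) * dA k (X $ l))) p \<otimes>\<^sub>C actV (matrix_unit i l) v))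
   + (\<Sum>l\<in>UNIV. \<Sum>k\<in>UNIV. actP (\<Sum>m\<in>UNIV. ofA (X $ m * dA m (dA k (Y $ l)))) p \<otimes>\<^sub>C actV (matrix_unit k l) v)
   - (\<Sum>l\<in>UNIV. \<Sum>k\<in>UNIV. actP (\<Sum>m\<in>UNIV. ofA (Y $ m * dA m (dA k (X $ l)))) p \<otimes>\<^sub>C actV (matrix_unit k l) v)"
    by (simp add: dA_bracket ofA_sum ofA_add P_sum P_lin(1) tens_lin tensL sum.distrib sum_subtractf)
  note 1 = this
  have "actP (vf (g_bracket X Y)) p = actP (vf X) (actP (vf Y) p) - actP (vf Y) (actP (vf X) p)"
    unfolding vf_bracket[symmetric] by (simp add: P_sum P_lin)
  then have 2: "actP (vf (g_bracket X Y)) p \<otimes>\<^sub>C v = actP (vf X) (actP (vf Y) p) \<otimes>\<^sub>C v - actP (vf Y) (actP (vf X) p) \<otimes>\<^sub>C v"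
    by (simp only: tensL(2))
  show ?case
    unfolding T_tens[of "g_bracket X Y"] TT by (rule abs_arith[OF 1 2 bilpart[of X Y p v]])
next
  case (add x y)
  then show ?case by (simp add: T_lin)
qed

lemma T_lie_module: "lie_module g_bracket (T_act actP actV)"
  unfolding lie_module_def cbilinear_def clinear_iff by (intro conjI allI T_lie T_lin T_linX)

end

end

theory Submission
  imports Defs "HOL-Computational_Algebra.Fundamental_Theorem_Algebra"
begin

text \<open>
  Write \<open>L(f, j)\<close> for the action of \<open>f d\<^sub>j \<in> \<gg>\<^sub>n\<close> on \<open>T(P, V)\<close>. A product \<open>L(f, j) L(g, l)\<close> is a
  bidifferential operator of total order at most two in \<open>(f, g)\<close>. A combination of four such
  products, the one with coefficients in \<open>(x\<^sub>a \<otimes> 1 - 1 \<otimes> x\<^sub>a) (x\<^sub>b \<otimes> 1 - 1 \<otimes> x\<^sub>b) (h \<otimes> 1)\<close>, kills all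
  terms except those of order two, and equals \<open>- h \<otimes> Q\<close> with
  \<open>Q = E\<^sub>a\<^sub>j E\<^sub>b\<^sub>l + E\<^sub>b\<^sub>j E\<^sub>a\<^sub>l - \<delta>\<^sub>j\<^sub>b E\<^sub>a\<^sub>l - \<delta>\<^sub>j\<^sub>a E\<^sub>b\<^sub>l\<close> (\<open>quadratic_identity\<close>). Since \<open>d\<^sub>m\<close> acts as
  \<open>d\<^sub>m \<otimes> 1\<close>, a \<open>\<gg>\<^sub>n\<close>-submodule \<open>M\<close> is stable under \<open>u \<otimes> Q\<close> for all \<open>u \<in> D\<^sub>n\<close> (\<open>submodule_quadratic\<close>).

  The largest \<open>D\<^sub>n\<close>-stable subspace of \<open>M\<close> is also stable under \<open>1 \<otimes> \<gg>\<ll>\<^sub>n\<close>, and \<open>P \<otimes> V\<close> is simple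
  over \<open>D\<^sub>n\<close> and \<open>\<gg>\<ll>\<^sub>n\<close> acting on the two factors (\<open>simple_outer_tensor\<close>). The latter rests on
  Schur's lemma for algebras of countable dimension over \<open>\<complex>\<close> (\<open>schur_countable_dim\<close>). So that
  subspace is zero if \<open>M\<close> is proper; it contains \<open>(1 \<otimes> Q) M\<close>, and therefore \<open>Q\<close> kills a nonzero
  vector of \<open>V\<close> if \<open>M \<noteq> 0\<close>. The common kernel of the operators \<open>Q\<close> on \<open>V\<close> is a submodule, hence
  equals \<open>V\<close>.

  Finally, the relations \<open>Q = 0\<close> are those satisfied in exterior powers. They make the \<open>E\<^sub>a\<^sub>a\<close>
  commuting idempotents, so weights are subsets of \<open>{1, \<dots>, n}\<close>; this forces a highest weight vector
  to exist, even though \<open>V\<close> may be infinite-dimensional a priori, and its weight to be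
  \<open>{1, \<dots>, r}\<close> (\<open>highest_weight_exists\<close>). That characterizes \<open>V(\<delta>\<^sub>r, r)\<close>.
\<close>

section \<open>Linear maps on tensor products\<close>

lemma clinear_simps:
  assumes "clinear f"
  shows "f (x + y) = f x + f y" "f (c *\<^sub>C x) = c *\<^sub>C f x" "f 0 = 0" "f (x - y) = f x - f y"
    "f (- x) = - f x" "f (sum g S) = (\<Sum>i\<in>S. f (g i))"
proof -
  interpret f: Vector_Spaces.linear scaleC scaleC f using assms by (simp add: clinear_def)
  show "f (x + y) = f x + f y" "f (c *\<^sub>C x) = c *\<^sub>C f x" "f 0 = 0" "f (x - y) = f x - f y"
    "f (- x) = - f x" "f (sum g S) = (\<Sum>i\<in>S. f (g i))"
    by (rule f.add f.scale f.zero f.diff f.neg f.sum)+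
qed

lemma clinear_ident [simp]: "clinear (\<lambda>x. x)"
  by (simp add: clinear_iff)

lemma clinear_add: "clinear f \<Longrightarrow> clinear g \<Longrightarrow> clinear (\<lambda>x. f x + g x)"
  by (simp add: clinear_iff algebra_simps scaleC_add_right)

lemma clinear_diff: "clinear f \<Longrightarrow> clinear g \<Longrightarrow> clinear (\<lambda>x. f x - g x)"
  by (simp add: clinear_iff algebra_simps complex_vector.scale_right_diff_distrib)

lemma clinear_scale: "clinear f \<Longrightarrow> clinear (\<lambda>x. c *\<^sub>C f x)"
  by (simp add: clinear_iff scaleC_add_right mult.commute scaleC_scaleC)

lemma clinear_compose: "clinear f \<Longrightarrow> clinear g \<Longrightarrow> clinear (\<lambda>x. f (g x))"
  by (simp add: clinear_iff)

lemma clinear_eq_on_tens: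
  assumes "clinear F" "clinear G" "\<And>p v. F (p \<otimes>\<^sub>C v) = G (p \<otimes>\<^sub>C v)"
  shows "F t = G t"
  by (induction t rule: tensor_induct) (use assms in \<open>simp_all add: clinear_iff\<close>)

lemma tens_0: "0 \<otimes>\<^sub>C v = 0" "p \<otimes>\<^sub>C 0 = 0"
  using tens_lin(3)[of 0 0 v] tens_lin(4)[of p 0 0] by simp_all

definition tensor_map :: "('p::complex_vector \<Rightarrow> 'q::complex_vector) \<Rightarrow>
    ('v::complex_vector \<Rightarrow> 'w::complex_vector) \<Rightarrow> ('p, 'v) tensor \<Rightarrow> ('q, 'w) tensor" where
  "tensor_map F G = tensor_lift (\<lambda>p v. F p \<otimes>\<^sub>C G v)"

lemma
  assumes "clinear F" "clinear G"
  shows tensor_map_tens: "tensor_map F G (p \<otimes>\<^sub>C v) = F p \<otimes>\<^sub>C G v"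
    and clinear_tensor_map: "clinear (tensor_map F G)"
proof -
  have "cbilinear (\<lambda>p v. F p \<otimes>\<^sub>C G v)"
    using assms by (simp add: cbilinear_def clinear_iff tens_lin)
  from tensor_lift_tens[OF this] clinear_tensor_lift[OF this]
  show "tensor_map F G (p \<otimes>\<^sub>C v) = F p \<otimes>\<^sub>C G v" "clinear (tensor_map F G)"
    by (simp_all add: tensor_map_def)
qed

text \<open>Contracting one tensor factor with a linear functional reduces questions about
  \<open>P \<otimes> V\<close> to questions about the other factor.\<close>

definition contract_right ::
  "('v::complex_vector \<Rightarrow> complex) \<Rightarrow> ('p::complex_vector, 'v) tensor \<Rightarrow> 'p" where
  "contract_right \<psi> = tensor_lift (\<lambda>p v. \<psi> v *\<^sub>C p)"

definition contract_left ::
  "('p::complex_vector \<Rightarrow> complex) \<Rightarrow> ('p, 'v::complex_vector) tensor \<Rightarrow> 'v" where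
  "contract_left \<phi> = tensor_lift (\<lambda>p v. \<phi> p *\<^sub>C v)"

lemma
  assumes "clinear \<psi>"
  shows contract_right_tens: "contract_right \<psi> (p \<otimes>\<^sub>C v) = \<psi> v *\<^sub>C p"
    and clinear_contract_right: "clinear (contract_right \<psi>)"
proof -
  have "cbilinear (\<lambda>p v. \<psi> v *\<^sub>C p)"
    using assms by (simp add: cbilinear_def clinear_iff scaleC_add_left scaleC_add_right
        scaleC_complex_def scaleC_scaleC mult.commute)
  from tensor_lift_tens[OF this] clinear_tensor_lift[OF this]
  show "contract_right \<psi> (p \<otimes>\<^sub>C v) = \<psi> v *\<^sub>C p" "clinear (contract_right \<psi>)"
    by (simp_all add: contract_right_def)
qed

lemma
  assumes "clinear \<phi>"
  shows contract_left_tens: "contract_left \<phi> (p \<otimes>\<^sub>C v) = \<phi> p *\<^sub>C v"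
    and clinear_contract_left: "clinear (contract_left \<phi>)"
proof -
  have "cbilinear (\<lambda>p v. \<phi> p *\<^sub>C v)"
    using assms by (simp add: cbilinear_def clinear_iff scaleC_add_left scaleC_add_right
        scaleC_complex_def scaleC_scaleC mult.commute)
  from tensor_lift_tens[OF this] clinear_tensor_lift[OF this]
  show "contract_left \<phi> (p \<otimes>\<^sub>C v) = \<phi> p *\<^sub>C v" "clinear (contract_left \<phi>)"
    by (simp_all add: contract_left_def)
qed

lemma contract_right_tensor_map:
  assumes "clinear \<psi>" "clinear F"
  shows "contract_right \<psi> (tensor_map F (\<lambda>v. v) t) = F (contract_right \<psi> t)"
  by (rule clinear_eq_on_tens)
    (simp_all add: assms tensor_map_tens clinear_tensor_map clinear_compose contract_right_tens
      clinear_contract_right clinear_simps(2)[OF assms(2)])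

lemma contract_left_tensor_map:
  assumes "clinear \<phi>" "clinear G"
  shows "contract_left \<phi> (tensor_map (\<lambda>p. p) G t) = G (contract_left \<phi> t)"
  by (rule clinear_eq_on_tens)
    (simp_all add: assms tensor_map_tens clinear_tensor_map clinear_compose contract_left_tens
      clinear_contract_left clinear_simps(2)[OF assms(2)])

lemma contract_commute:
  assumes "clinear \<phi>" "clinear \<psi>"
  shows "\<phi> (contract_right \<psi> t) = \<psi> (contract_left \<phi> t)"
  by (rule clinear_eq_on_tens)
    (simp_all add: assms clinear_compose contract_left_tens contract_right_tens
      clinear_contract_left clinear_contract_right clinear_simps(2)[OF assms(2)]
      clinear_simps(2)[OF assms(1)] scaleC_complex_def mult.commute)

definition is_basis :: "'v::complex_vector set \<Rightarrow> bool" where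
  "is_basis B \<longleftrightarrow> \<not> complex_vector.dependent B \<and> complex_vector.span B = UNIV"

lemma is_basis_exists: "\<exists>B::'v::complex_vector set. is_basis B"
  proof -
  obtain B :: "'v set" where "\<not> complex_vector.dependent B" "UNIV \<subseteq> complex_vector.span B"
    using complex_vector.basis_exists[of "UNIV :: 'v set"] by metis
  then show ?thesis unfolding is_basis_def by blast
qed

text \<open>The coordinates of a tensor in a basis \<open>B\<close> of the right factor are vectors of the left one:
  \<open>t\<close> is the sum of the tensors \<open>contract_right (coord B b) t \<otimes> b\<close>.\<close>

definition coord :: "'v::complex_vector set \<Rightarrow> 'v \<Rightarrow> 'v \<Rightarrow> complex" where
  "coord B b v = complex_vector.representation B v b"

lemma clinear_coord:
  assumes "is_basis B"
  shows "clinear (coord B b)"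
  using assms unfolding is_basis_def clinear_iff coord_def
  by (simp add: complex_vector.representation_add complex_vector.representation_scale
      scaleC_complex_def)

lemma finite_coord: "finite {b. coord B b v \<noteq> 0}"
  unfolding coord_def by (rule complex_vector.finite_representation)

lemma sum_coord:
  assumes "is_basis B"
  shows "(\<Sum>b | coord B b v \<noteq> 0. coord B b v *\<^sub>C b) = v"
  using assms unfolding is_basis_def coord_def
  by (simp add: complex_vector.sum_nonzero_representation_eq)

lemma functional_nonzero:
  fixes v :: "'v::complex_vector"
  assumes "v \<noteq> 0"
  shows "\<exists>\<phi>::'v \<Rightarrow> complex. clinear \<phi> \<and> \<phi> v \<noteq> 0"
proof -
  obtain B :: "'v set" where B: "is_basis B" using is_basis_exists by blast
  have "\<exists>b. coord B b v \<noteq> 0"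
  proof (rule ccontr)
    assume "\<nexists>b. coord B b v \<noteq> 0"
    then show False using sum_coord[OF B, of v] assms by simp
  qed
  then obtain b where "coord B b v \<noteq> 0" ..
  then show ?thesis using clinear_coord[OF B, of b] by blast
qed

lemma finite_contract_coord:
  assumes "is_basis B"
  shows "finite {b. contract_right (coord B b) t \<noteq> 0}"
proof (induction t rule: tensor_induct)
  case (tens p v)
  show ?case
    by (rule finite_subset[OF _ finite_coord[of B v]])
      (auto simp: contract_right_tens[OF clinear_coord[OF assms]])
next
  case (add x y)
  show ?case
    by (rule finite_subset[OF _ finite_UnI[OF add]])
      (auto simp: clinear_simps(1)[OF clinear_contract_right[OF clinear_coord[OF assms]]])
qed

lemma sum_contract_coord:
  assumes B: "is_basis B"
  shows "(\<Sum>b | contract_right (coord B b) t \<noteq> 0. contract_right (coord B b) t \<otimes>\<^sub>C b) = t"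
proof (induction t rule: tensor_induct)
  case (tens p v)
  let ?S = "{b. coord B b v \<noteq> 0}"
  have "(\<Sum>b | contract_right (coord B b) (p \<otimes>\<^sub>C v) \<noteq> 0. contract_right (coord B b) (p \<otimes>\<^sub>C v) \<otimes>\<^sub>C b)
      = (\<Sum>b\<in>?S. contract_right (coord B b) (p \<otimes>\<^sub>C v) \<otimes>\<^sub>C b)"
    by (rule sum.mono_neutral_left[OF finite_coord])
      (auto simp: contract_right_tens[OF clinear_coord[OF B]] tens_0)
  also have "\<dots> = p \<otimes>\<^sub>C (\<Sum>b\<in>?S. coord B b v *\<^sub>C b)"
    by (simp add: contract_right_tens[OF clinear_coord[OF B]] tensR(1) tens_lin)
  also have "\<dots> = p \<otimes>\<^sub>C v" by (simp only: sum_coord[OF B])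
  finally show ?case .
next
  case (add x y)
  let ?c = "\<lambda>t b. contract_right (coord B b) t"
  let ?K = "{b. ?c x b \<noteq> 0} \<union> {b. ?c y b \<noteq> 0}"
  have fin: "finite ?K" using finite_contract_coord[OF B] by blast
  have plus: "?c (x + y) b = ?c x b + ?c y b" for b
    by (rule clinear_simps(1)[OF clinear_contract_right[OF clinear_coord[OF B]]])
  have ext: "(\<Sum>b | ?c t b \<noteq> 0. ?c t b \<otimes>\<^sub>C b) = (\<Sum>b\<in>?K. ?c t b \<otimes>\<^sub>C b)"
    if "{b. ?c t b \<noteq> 0} \<subseteq> ?K" for t
    using that by (intro sum.mono_neutral_left[OF fin]) (auto simp: tens_0)
  have "(\<Sum>b | ?c (x + y) b \<noteq> 0. ?c (x + y) b \<otimes>\<^sub>C b) = (\<Sum>b\<in>?K. ?c (x + y) b \<otimes>\<^sub>C b)"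
    by (rule ext) (auto simp: plus)
  also have "\<dots> = (\<Sum>b\<in>?K. ?c x b \<otimes>\<^sub>C b) + (\<Sum>b\<in>?K. ?c y b \<otimes>\<^sub>C b)"
    by (simp add: plus tens_lin sum.distrib)
  also have "\<dots> = x + y"
    using ext[of x] ext[of y] add by auto
  finally show ?case .
qed

lemma tensor_eq_0I:
  assumes "is_basis B" "\<And>b. contract_right (coord B b) t = 0"
  shows "t = 0"
  using sum_contract_coord[OF assms(1), of t] assms(2) by simp

text \<open>A nonzero coordinate of \<open>t\<close> is detected by a functional \<open>\<phi>\<close>, and the two contractions
  commute.\<close>

lemma contract_left_nonzero:
  fixes t :: "('p::complex_vector, 'v::complex_vector) tensor"
  assumes "t \<noteq> 0"
  shows "\<exists>\<phi>. clinear \<phi> \<and> contract_left \<phi> t \<noteq> 0"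
proof -
  obtain B :: "'v set" where B: "is_basis B" using is_basis_exists by blast
  have "\<exists>b. contract_right (coord B b) t \<noteq> 0"
  proof (rule ccontr)
    assume "\<nexists>b. contract_right (coord B b) t \<noteq> 0"
    then have "t = 0" by (intro tensor_eq_0I[OF B]) simp
    with assms show False ..
  qed
  then obtain b where b: "contract_right (coord B b) t \<noteq> 0" ..
  obtain \<phi> :: "'p \<Rightarrow> complex" where \<phi>: "clinear \<phi>" "\<phi> (contract_right (coord B b) t) \<noteq> 0"
    using functional_nonzero[OF b] by auto
  then have "coord B b (contract_left \<phi> t) \<noteq> 0"
    using contract_commute[OF \<phi>(1) clinear_coord[OF B], of b t] by simp
  then have "contract_left \<phi> t \<noteq> 0"
    by (auto simp: clinear_simps(3)[OF clinear_coord[OF B]])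
  with \<phi>(1) show ?thesis by (intro exI[of _ \<phi>] conjI)
qed

section \<open>Schur's lemma in countable dimension\<close>

text \<open>Every vector of the independent set lies in the span of a finite subset of the countable
  spanning set; there are countably many such subsets, and each span contains only finitely many
  independent vectors.\<close>

lemma countable_independent:
  fixes B I :: "'m::complex_vector set"
  assumes "countable B" "complex_vector.span B = UNIV" "\<not> complex_vector.dependent I"
  shows "countable I"
proof -
  have "I \<subseteq> (\<Union>F\<in>{F. finite F \<and> F \<subseteq> B}. I \<inter> complex_vector.span F)"
  proof
    fix v assume v: "v \<in> I"
    have "v \<in> complex_vector.span B" using assms by simp
    then obtain F r where "finite F" "F \<subseteq> B" "v = (\<Sum>a\<in>F. r a *\<^sub>C a)"
      unfolding complex_vector.span_explicit by blast
    moreover from this have "v \<in> complex_vector.span F"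
      unfolding complex_vector.span_explicit by blast
    ultimately show "v \<in> (\<Union>F\<in>{F. finite F \<and> F \<subseteq> B}. I \<inter> complex_vector.span F)"
      using v by blast
  qed
  moreover have "countable (I \<inter> complex_vector.span F)" if F: "finite F" for F
  proof -
    have "\<not> complex_vector.dependent (I \<inter> complex_vector.span F)"
      using assms(3) complex_vector.dependent_mono by blast
    from complex_vector.independent_span_bound[OF F this]
    show ?thesis by (simp add: uncountable_infinite countable_finite)
  qed
  moreover have "countable {F. finite F \<and> F \<subseteq> B}"
    by (rule countable_Collect_finite_subset[OF assms(1)])
  ultimately show ?thesis
    by (elim countable_subset) (intro countable_UN, auto)
qed

text \<open>Evaluation of a polynomial at an operator, by Horner's scheme.\<close>

definition poly_op :: "('m::complex_vector \<Rightarrow> 'm) \<Rightarrow> complex poly \<Rightarrow> 'm \<Rightarrow> 'm" where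
  "poly_op \<phi> f = fold_coeffs (\<lambda>a g m. a *\<^sub>C m + \<phi> (g m)) f (\<lambda>_. 0)"

context
  fixes \<phi> :: "'m::complex_vector \<Rightarrow> 'm"
  assumes \<phi>: "clinear \<phi>"
begin

lemma poly_op_0: "poly_op \<phi> 0 m = 0"
  by (simp add: poly_op_def)

lemma poly_op_pCons: "poly_op \<phi> (pCons a f) m = a *\<^sub>C m + \<phi> (poly_op \<phi> f m)"
  by (cases "f = 0 \<and> a = 0") (auto simp: poly_op_def clinear_simps[OF \<phi>])

lemma clinear_poly_op: "clinear (poly_op \<phi> f)"
proof (induction f)
  case 0
  then show ?case by (simp add: clinear_iff poly_op_0)
next
  case (pCons a f)
  then have "clinear (\<lambda>m. a *\<^sub>C m + \<phi> (poly_op \<phi> f m))"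
    by (intro clinear_add clinear_scale clinear_compose[OF \<phi>] clinear_ident)
  then show ?case by (simp add: poly_op_pCons)
qed

lemma poly_op_add: "poly_op \<phi> (f + g) m = poly_op \<phi> f m + poly_op \<phi> g m"
  by (induction f g rule: poly_induct2)
    (simp_all add: poly_op_0 poly_op_pCons scaleC_add_left clinear_simps[OF \<phi>] algebra_simps)

lemma poly_op_sum: "poly_op \<phi> (sum f S) m = (\<Sum>i\<in>S. poly_op \<phi> (f i) m)"
  by (induction S rule: infinite_finite_induct) (simp_all add: poly_op_0 poly_op_add)

lemma poly_op_smult: "poly_op \<phi> (smult c f) m = c *\<^sub>C poly_op \<phi> f m"
  by (induction f)
    (simp_all add: poly_op_0 poly_op_pCons scaleC_add_right scaleC_scaleC clinear_simps[OF \<phi>])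

lemma poly_op_mult: "poly_op \<phi> (f * g) m = poly_op \<phi> f (poly_op \<phi> g m)"
  by (induction f) (simp_all add: poly_op_0 poly_op_pCons poly_op_add poly_op_smult)

lemma poly_op_linear_factor: "poly_op \<phi> [:- c, 1:] m = \<phi> m - c *\<^sub>C m"
  by (simp add: poly_op_pCons poly_op_0 scaleC_one clinear_simps[OF \<phi>])

text \<open>Apply the linear factors of \<open>f\<close> to \<open>m\<close> one after the other: the first one to give zero was
  applied to an eigenvector.\<close>

lemma eigenvector_if_annihilated:
  assumes "f \<noteq> 0" "poly_op \<phi> f m = 0" "m \<noteq> 0"
  shows "\<exists>c w. w \<noteq> 0 \<and> \<phi> w = c *\<^sub>C w"
  using assms
proof (induction "degree f" arbitrary: f)
  case 0
  then obtain a where "f = [:a:]" using degree_eq_zeroE by metis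
  with 0 show ?case by (simp add: poly_op_pCons poly_op_0 clinear_simps[OF \<phi>])
next
  case (Suc k)
  have "\<not> constant (poly f)"
    using Suc.hyps(2) by (simp add: constant_degree)
  then obtain z where "poly f z = 0" using fundamental_theorem_of_algebra by blast
  then obtain g where g: "f = [:- z, 1:] * g" by (auto simp: poly_eq_0_iff_dvd)
  show ?case
  proof (cases "poly_op \<phi> g m = 0")
    case True
    have "g \<noteq> 0" using Suc.prems g by auto
    moreover from this have "degree f = Suc (degree g)"
      unfolding g by (subst degree_mult_eq) auto
    ultimately show ?thesis using Suc True by auto
  next
    case False
    have "\<phi> (poly_op \<phi> g m) = z *\<^sub>C poly_op \<phi> g m"
      using Suc.prems(2) unfolding g poly_op_mult poly_op_linear_factor by simp
    with False show ?thesis by blast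
  qed
qed

text \<open>If every \<open>\<phi> - c\<close> were invertible, the vectors \<open>(\<phi> - c)\<inverse> p\<close> would form an uncountable
  family, hence a linearly dependent one. Clearing denominators in a linear relation between them
  gives a nonzero polynomial in \<open>\<phi>\<close> that annihilates \<open>p\<close>, and therefore an eigenvector.\<close>

lemma countable_dim_spectrum_nonempty:
  assumes B: "countable B" "complex_vector.span B = (UNIV :: 'm set)"
    and p: "(p :: 'm) \<noteq> 0"
  shows "\<exists>c. \<not> bij (\<lambda>m. \<phi> m - c *\<^sub>C m)"
proof (rule ccontr)
  assume "\<nexists>c. \<not> bij (\<lambda>m. \<phi> m - c *\<^sub>C m)"
  then have bij: "bij (\<lambda>m. \<phi> m - c *\<^sub>C m)" for c by blast
  define q where "q c = inv (\<lambda>m. \<phi> m - c *\<^sub>C m) p" for c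
  have q: "\<phi> (q c) - c *\<^sub>C q c = p" for c
    using bij_is_surj[OF bij[of c]] surj_f_inv_f[of "\<lambda>m. \<phi> m - c *\<^sub>C m" p] by (simp add: q_def)
  have q0: "q c \<noteq> 0" for c using q[of c] p by (auto simp: clinear_simps[OF \<phi>])
  have "inj q"
  proof (rule injI)
    fix c d assume cd: "q c = q d"
    have "\<phi> (q c) - c *\<^sub>C q c = \<phi> (q c) - d *\<^sub>C q c" using q[of c] q[of d] cd by simp
    then have "(c - d) *\<^sub>C q c = 0"
      by (simp add: complex_vector.scale_left_diff_distrib)
    then show "c = d" using q0[of c] by simp
  qed
  have "uncountable (UNIV :: complex set)"
    using uncountable_UNIV_complex .
  then have "uncountable (range q)"
    using \<open>inj q\<close> countable_image_inj_on by blast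
  then have "complex_vector.dependent (range q)"
    using countable_independent[OF B] by blast
  then obtain T u v where T: "finite T" "T \<subseteq> range q" "v \<in> T" "u v \<noteq> 0" "(\<Sum>w\<in>T. u w *\<^sub>C w) = 0"
    unfolding complex_vector.dependent_explicit by blast
  define L where "L = q -` T"
  have L: "finite L" "q ` L = T"
    using T \<open>inj q\<close> by (auto simp: L_def intro: finite_vimageI)
  have rel: "(\<Sum>c\<in>L. u (q c) *\<^sub>C q c) = 0"
    using T(5) unfolding L(2)[symmetric]
    by (subst (asm) sum.reindex) (auto intro: inj_on_subset[OF \<open>inj q\<close>])
  obtain c0 where c0: "c0 \<in> L" "u (q c0) \<noteq> 0" using T L by blast
  \<comment> \<open>the numerator of \<open>\<Sum>c\<in>L. u (q c) / (X - c)\<close>\<close>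
  define f where "f = (\<Sum>c\<in>L. smult (u (q c)) (\<Prod>d\<in>L - {c}. [:- d, 1:]))"
  have "poly f c0 = (\<Sum>c\<in>L. if c = c0 then u (q c0) * (\<Prod>d\<in>L - {c0}. c0 - d) else 0)"
    unfolding f_def poly_sum poly_smult poly_prod
  proof (rule sum.cong[OF refl], goal_cases)
    case (1 c)
    have "(\<Prod>d\<in>L - {c}. poly [:- d, 1:] c0) = 0" if "c \<noteq> c0"
      using L(1) c0(1) that by (intro prod_zero) auto
    then show ?case by auto
  qed
  also have "\<dots> = u (q c0) * (\<Prod>d\<in>L - {c0}. c0 - d)"
    using L(1) c0 by simp
  also have "\<dots> \<noteq> 0" using L(1) c0 by simp
  finally have "f \<noteq> 0" by auto
  have "poly_op \<phi> f p = (\<Sum>c\<in>L. u (q c) *\<^sub>C poly_op \<phi> (\<Prod>d\<in>L. [:- d, 1:]) (q c))"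
    unfolding f_def poly_op_sum poly_op_smult
  proof (rule sum.cong[OF refl], goal_cases)
    case (1 c)
    have "poly_op \<phi> (\<Prod>d\<in>L - {c}. [:- d, 1:]) p
        = poly_op \<phi> ((\<Prod>d\<in>L - {c}. [:- d, 1:]) * [:- c, 1:]) (q c)"
      unfolding poly_op_mult poly_op_linear_factor q ..
    also have "(\<Prod>d\<in>L - {c}. [:- d, 1:]) * [:- c, 1:] = (\<Prod>d\<in>L. [:- d, 1:])"
      by (simp add: prod.remove[OF L(1) 1] mult.commute)
    finally show ?case by simp
  qed
  also have "\<dots> = poly_op \<phi> (\<Prod>d\<in>L. [:- d, 1:]) (\<Sum>c\<in>L. u (q c) *\<^sub>C q c)"
    by (simp add: clinear_simps[OF clinear_poly_op])
  also have "\<dots> = 0" by (simp add: rel clinear_simps[OF clinear_poly_op])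
  finally obtain c w where "w \<noteq> 0" "\<phi> w = c *\<^sub>C w"
    using eigenvector_if_annihilated[OF \<open>f \<noteq> 0\<close> _ p] by blast
  moreover have "\<phi> 0 - c *\<^sub>C 0 = 0" by (simp add: clinear_simps[OF \<phi>])
  ultimately show False
    using injD[OF bij_is_inj[OF bij[of c]], of w 0] by simp
qed

end

text \<open>Kernel and image of \<open>\<phi> - c\<close> are submodules, so a point \<open>c\<close> of the spectrum of \<open>\<phi>\<close>
  makes \<open>\<phi> - c\<close> vanish.\<close>

lemma schur_countable_dim:
  fixes act :: "'a \<Rightarrow> 'm::complex_vector \<Rightarrow> 'm"
  assumes act: "\<And>u. clinear (act u)" and simple: "simple_module UNIV act"
    and B: "countable B" "complex_vector.span B = (UNIV :: 'm set)"
    and \<phi>: "clinear \<phi>" and comm: "\<And>u m. \<phi> (act u m) = act u (\<phi> m)"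
  shows "\<exists>c. \<forall>m. \<phi> m = c *\<^sub>C m"
proof -
  obtain p :: 'm where p: "p \<noteq> 0" using simple unfolding simple_module_def by blast
  obtain c where c: "\<not> bij (\<lambda>m. \<phi> m - c *\<^sub>C m)"
    using countable_dim_spectrum_nonempty[OF \<phi> B p] by blast
  define \<theta> where "\<theta> m = \<phi> m - c *\<^sub>C m" for m
  have lin: "clinear \<theta>"
    unfolding \<theta>_def by (intro clinear_diff \<phi> clinear_scale clinear_ident)
  have \<theta>: "\<theta> (act u m) = act u (\<theta> m)" for u m
    by (simp add: \<theta>_def comm clinear_simps[OF act])
  interpret \<theta>: Vector_Spaces.linear scaleC scaleC \<theta> using lin by (simp add: clinear_def)
  have "submodule UNIV act {m. \<theta> m = 0}"
    unfolding submodule_def using \<theta>.subspace_kernel by (auto simp: \<theta> clinear_simps[OF act])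
  then have ker: "{m. \<theta> m = 0} = {0} \<or> {m. \<theta> m = 0} = UNIV"
    using simple unfolding simple_module_def by blast
  have "submodule UNIV act (range \<theta>)"
    unfolding submodule_def using \<theta>.subspace_image[OF complex_vector.subspace_UNIV]
    by (auto simp: \<theta>[symmetric])
  then have im: "range \<theta> = {0} \<or> range \<theta> = UNIV"
    using simple unfolding simple_module_def by blast
  have "\<not> bij \<theta>" using c unfolding \<theta>_def .
  then have "\<theta> m = 0" for m
  proof (cases "range \<theta> = UNIV")
    case True
    then have "\<not> inj \<theta>" using \<open>\<not> bij \<theta>\<close> by (simp add: bij_def)
    then have "{m. \<theta> m = 0} \<noteq> {0}"
      by (auto simp: \<theta>.inj_iff_eq_0)
    with ker show ?thesis by auto
  next
    case False
    with im show ?thesis by auto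
  qed
  then show ?thesis by (auto simp: \<theta>_def)
qed

lemma algebra_moduleD:
  assumes "algebra_module act"
  shows "clinear (act u)" "clinear (\<lambda>u. act u m)" "act 1 m = m" "act (u * v) m = act u (act v m)"
  using assms by (simp_all add: algebra_module_def cbilinear_def)

lemma simple_algebra_module_generated:
  fixes act :: "'a::{complex_vector, ring, monoid_mult} \<Rightarrow> 'm::complex_vector \<Rightarrow> 'm"
  assumes act: "algebra_module act" and simple: "simple_module UNIV act" and "p \<noteq> 0"
  shows "range (\<lambda>u. act u p) = UNIV"
proof -
  interpret p: Vector_Spaces.linear scaleC scaleC "\<lambda>u. act u p"
    using algebra_moduleD(2)[OF act] by (simp add: clinear_def)
  have "submodule UNIV act (range (\<lambda>u. act u p))"
    unfolding submodule_def using p.subspace_image[OF complex_vector.subspace_UNIV]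
    by (auto simp: algebra_moduleD(4)[OF act, symmetric])
  moreover have "p \<in> range (\<lambda>u. act u p)" by (metis algebra_moduleD(3)[OF act] rangeI)
  ultimately show ?thesis using simple \<open>p \<noteq> 0\<close> unfolding simple_module_def by blast
qed

text \<open>The rule \<open>u p \<mapsto> u q\<close> is a well-defined endomorphism of the module, hence a scalar.\<close>

lemma proportional_if_annihilator_le:
  fixes act :: "'a::{complex_vector, ring, monoid_mult} \<Rightarrow> 'm::complex_vector \<Rightarrow> 'm"
  assumes act: "algebra_module act" and simple: "simple_module UNIV act"
    and B: "countable B" "complex_vector.span B = (UNIV :: 'a set)"
    and p: "p \<noteq> 0" and ann: "\<And>u. act u p = 0 \<Longrightarrow> act u q = 0"
  shows "\<exists>c. q = c *\<^sub>C p"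
proof -
  note lin = clinear_simps[OF algebra_moduleD(2)[OF act]]
  note gen = simple_algebra_module_generated[OF act simple p]
  interpret p: Vector_Spaces.linear scaleC scaleC "\<lambda>u. act u p"
    using algebra_moduleD(2)[OF act] by (simp add: clinear_def)
  have span: "complex_vector.span ((\<lambda>u. act u p) ` B) = UNIV"
    using p.span_image[of B] B(2) gen by simp
  define \<phi> where "\<phi> m = act (SOME u. act u p = m) q" for m
  have \<phi>: "\<phi> (act u p) = act u q" for u
  proof -
    let ?v = "SOME v. act v p = act u p"
    have "act ?v p = act u p" by (rule someI[of _ u]) simp
    then have "act (?v - u) p = 0" by (simp add: lin)
    then have "act (?v - u) q = 0" by (rule ann)
    then show ?thesis by (simp add: \<phi>_def lin)
  qed
  have surj: "\<exists>u. m = act u p" for m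
    using gen by (metis rangeE UNIV_I)
  have "clinear \<phi>" unfolding clinear_iff
  proof (intro conjI allI)
    fix x y c
    obtain u v where uv: "x = act u p" "y = act v p" using surj by metis
    show "\<phi> (x + y) = \<phi> x + \<phi> y"
      unfolding uv lin(1)[symmetric] \<phi> ..
    show "\<phi> (c *\<^sub>C x) = c *\<^sub>C \<phi> x"
      unfolding uv lin(2)[symmetric] \<phi> ..
  qed
  moreover have "\<phi> (act u m) = act u (\<phi> m)" for u m
  proof -
    obtain v where v: "m = act v p" using surj by metis
    show ?thesis unfolding v \<phi> algebra_moduleD(4)[OF act, symmetric] ..
  qed
  ultimately obtain c where "\<And>m. \<phi> m = c *\<^sub>C m"
    using schur_countable_dim[OF algebra_moduleD(1)[OF act] simple countable_image[OF B(1)] span]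
    by blast
  moreover have "\<phi> p = q" using \<phi>[of 1] by (simp add: algebra_moduleD[OF act])
  ultimately show ?thesis by metis
qed

section \<open>Outer tensor products of simple modules\<close>

text \<open>Take a nonzero \<open>t \<in> N\<close> with as few nonzero coordinates as possible with respect to a basis
  of \<open>V\<close>. If \<open>u\<close> annihilates one of them, then \<open>u t\<close> has fewer, so it is zero, and \<open>u\<close>
  annihilates them all. By Schur's lemma the coordinates are proportional: \<open>t\<close> is a pure tensor.
  From a pure tensor, simplicity of the two factors produces everything.\<close>

lemma simple_outer_tensor:
  fixes act :: "'a::{complex_vector, ring, monoid_mult} \<Rightarrow> 'p::complex_vector \<Rightarrow> 'p"
    and actV :: "'l \<Rightarrow> 'v::complex_vector \<Rightarrow> 'v"
  assumes act: "algebra_module act" and simpleP: "simple_module UNIV act"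
    and B: "countable B" "complex_vector.span B = (UNIV :: 'a set)"
    and linV: "\<And>x. clinear (actV x)" and simpleV: "simple_module UNIV actV"
    and N: "complex_vector.subspace N"
      "\<And>u t. t \<in> N \<Longrightarrow> tensor_map (act u) (\<lambda>v. v) t \<in> N"
      "\<And>x t. t \<in> N \<Longrightarrow> tensor_map (\<lambda>p. p) (actV x) t \<in> N"
    and "N \<noteq> {0}"
  shows "N = UNIV"
proof -
  note linP = algebra_moduleD(1)[OF act]
  obtain C :: "'v set" where C: "is_basis C" using is_basis_exists by blast
  define c where "c t b = contract_right (coord C b) t" for t :: "('p, 'v) tensor" and b
  define supp where "supp t = {b. c t b \<noteq> 0}" for t
  have fin: "finite (supp t)" for t
    unfolding supp_def c_def by (rule finite_contract_coord[OF C])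
  have c0: "c 0 b = 0" for b
    unfolding c_def by (rule clinear_simps(3)[OF clinear_contract_right[OF clinear_coord[OF C]]])
  have c_act: "c (tensor_map (act u) (\<lambda>v. v) t) b = act u (c t b)" for u t b
    unfolding c_def by (rule contract_right_tensor_map[OF clinear_coord[OF C] linP])
  have "\<exists>t. t \<in> N \<and> t \<noteq> 0"
    using \<open>N \<noteq> {0}\<close> complex_vector.subspace_0[OF N(1)] by auto
  then obtain t where t: "t \<in> N" "t \<noteq> 0"
    and min: "\<And>s. s \<in> N \<Longrightarrow> s \<noteq> 0 \<Longrightarrow> card (supp t) \<le> card (supp s)"
    using ex_has_least_nat[of "\<lambda>t. t \<in> N \<and> t \<noteq> 0" _ "\<lambda>t. card (supp t)"] by metis
  have "\<exists>b. c t b \<noteq> 0"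
  proof (rule ccontr)
    assume "\<nexists>b. c t b \<noteq> 0"
    then have "t = 0" by (intro tensor_eq_0I[OF C]) (simp add: c_def)
    with t show False by simp
  qed
  then obtain b0 where b0: "c t b0 \<noteq> 0" ..
  have "\<exists>k. c t b = k *\<^sub>C c t b0" for b
  proof (rule proportional_if_annihilator_le[OF act simpleP B b0])
    fix u assume u: "act u (c t b0) = 0"
    let ?s = "tensor_map (act u) (\<lambda>v. v) t"
    have "supp ?s \<subset> supp t"
      unfolding supp_def c_act using u b0 by (auto simp: clinear_simps[OF linP])
    then have "card (supp ?s) < card (supp t)" by (rule psubset_card_mono[OF fin])
    then have "?s = 0" using min[of ?s] N(2)[OF t(1)] by fastforce
    then show "act u (c t b) = 0" by (simp add: c0 flip: c_act)
  qed
  then obtain k where k: "\<And>b. c t b = k b *\<^sub>C c t b0" by metis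
  define v0 where "v0 = (\<Sum>b\<in>supp t. k b *\<^sub>C b)"
  have "t = (\<Sum>b\<in>supp t. c t b \<otimes>\<^sub>C b)"
    unfolding supp_def c_def by (rule sum_contract_coord[OF C, symmetric])
  also have "\<dots> = (\<Sum>b\<in>supp t. c t b0 \<otimes>\<^sub>C (k b *\<^sub>C b))"
    by (rule sum.cong[OF refl], subst k) (simp add: tens_lin)
  also have "\<dots> = c t b0 \<otimes>\<^sub>C v0" by (simp add: v0_def tensR(1))
  finally have t_eq: "t = c t b0 \<otimes>\<^sub>C v0" .
  have v0: "v0 \<noteq> 0" using t_eq t(2) tens_0(2) by metis
  have "submodule UNIV actV {v. c t b0 \<otimes>\<^sub>C v \<in> N}"
    unfolding submodule_def
  proof (intro conjI ballI)
    show "complex_vector.subspace {v. c t b0 \<otimes>\<^sub>C v \<in> N}"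
      using N(1) by (simp add: complex_vector.subspace_def tens_lin tens_0)
    fix x v assume "v \<in> {v. c t b0 \<otimes>\<^sub>C v \<in> N}"
    then have "tensor_map (\<lambda>p. p) (actV x) (c t b0 \<otimes>\<^sub>C v) \<in> N" by (intro N(3)) simp
    then show "actV x v \<in> {v. c t b0 \<otimes>\<^sub>C v \<in> N}"
      by (simp add: tensor_map_tens linV)
  qed
  moreover have "v0 \<in> {v. c t b0 \<otimes>\<^sub>C v \<in> N}" using t_eq t(1) by simp
  ultimately have "{v. c t b0 \<otimes>\<^sub>C v \<in> N} = UNIV"
    using simpleV v0 unfolding simple_module_def by blast
  then have all_v: "c t b0 \<otimes>\<^sub>C v \<in> N" for v by blast
  have "p \<otimes>\<^sub>C v \<in> N" for p v
  proof -
    obtain u where "p = act u (c t b0)"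
      using simple_algebra_module_generated[OF act simpleP b0] by (metis UNIV_I rangeE)
    then have "p \<otimes>\<^sub>C v = tensor_map (act u) (\<lambda>v. v) (c t b0 \<otimes>\<^sub>C v)"
      by (simp add: tensor_map_tens linP)
    then show ?thesis using N(2)[OF all_v] by simp
  qed
  then have "s \<in> N" for s
    by (induction s rule: tensor_induct) (use N(1) in \<open>auto simp: complex_vector.subspace_def\<close>)
  then show ?thesis by blast
qed

section \<open>The algebra of differential operators\<close>

lemma ofA_0: "ofA 0 = 0"
  using ofA_sum(2)[of 0 0] by simp

lemma ofA_scalar: "ofA (c *\<^sub>C 1) * u = c *\<^sub>C u"
  by (simp add: ofA_scaleC ofA_one D_scaleC_mult)

text \<open>The hypothesis on \<open>A\<^sub>n\<close> covers scalars, which are the constants of \<open>A\<^sub>n\<close>.\<close>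

lemma D_induct [case_names one ofA dD add]:
  fixes u :: "'n D"
  assumes one: "Q 1" and ofA: "\<And>f u. Q u \<Longrightarrow> Q (ofA f * u)" and dD: "\<And>i u. Q u \<Longrightarrow> Q (dD i * u)"
    and add: "\<And>u w. Q u \<Longrightarrow> Q w \<Longrightarrow> Q (u + w)"
  shows "Q u"
proof (induction u rule: D.abs_induct)
  case (1 z)
  show ?case
  proof (induction z rule: poly_mapping_lin_induct)
    case (single k c)
    obtain gs where k: "k = Letters gs" by (cases k)
    have word: "Q (abs_D (Poly_Mapping.single (Letters gs) 1))"
    proof (induction gs)
      case Nil
      have "Poly_Mapping.single (Letters []) 1 = (1 :: 'n D_free)"
        by (simp flip: zero_free_monoid_def)
      then show ?case using one by (simp add: one_D_def)
    next
      case (Cons g gs)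
      have "Poly_Mapping.single (Letters (g # gs)) 1
          = gen g * (Poly_Mapping.single (Letters gs) 1 :: 'n D_free)"
        by (simp add: gen_def mult_single)
      then have "abs_D (Poly_Mapping.single (Letters (g # gs)) 1)
          = abs_D (gen g) * abs_D (Poly_Mapping.single (Letters gs) 1)"
        by (simp add: times_D.abs_eq)
      then show ?case
        using ofA[OF Cons] dD[OF Cons] by (cases g) (simp_all add: ofA.abs_eq dD.abs_eq)
    qed
    have "abs_D (Poly_Mapping.single k c) = ofA (c *\<^sub>C 1) * abs_D (Poly_Mapping.single k 1)"
      by (simp add: ofA_scalar scaleC_D.abs_eq scaleC_complex_def)
    then show ?case using ofA[OF word] by (simp add: k)
  next
    case (add x y)
    then show ?case using assms(4) by (simp flip: plus_D.abs_eq)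
  qed
qed

lemma countable_UNIV_poly_mapping:
  "countable (UNIV :: ('n::finite \<Rightarrow>\<^sub>0 'c::{zero, countable}) set)"
proof (rule countableI')
  show "inj (\<lambda>f. to_nat (Poly_Mapping.lookup (f :: 'n \<Rightarrow>\<^sub>0 'c)))"
    by (simp add: inj_def lookup_inject)
qed

text \<open>The words in the monomials of \<open>A\<^sub>n\<close> and the \<open>d\<^sub>i\<close> span \<open>D\<^sub>n\<close>.\<close>

lemma D_countable_dim: "\<exists>B. countable B \<and> complex_vector.span B = (UNIV :: 'n::finite D set)"
proof -
  define G :: "'n D set" where "G = range (\<lambda>k. ofA (Poly_Mapping.single k 1)) \<union> range dD"
  define B where "B = prod_list ` lists G"
  have "countable (UNIV :: (('n \<Rightarrow>\<^sub>0 int) \<times> ('n \<Rightarrow>\<^sub>0 nat)) set)"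
    unfolding UNIV_Times_UNIV[symmetric]
    by (intro countable_SIGMA countable_UNIV_poly_mapping)
  then have "countable G" by (auto simp: G_def)
  then have "countable B" by (auto simp: B_def)
  have gen: "g * u \<in> complex_vector.span B" if g: "g \<in> G" and u: "u \<in> complex_vector.span B" for g u
    using u
  proof (induction u rule: complex_vector.span_induct)
    case base
    show ?case
      by (simp add: complex_vector.subspace_def distrib_left complex_vector.span_zero
          complex_vector.span_add D_scaleC_mult complex_vector.span_scale)
  next
    case (step w)
    then obtain gs where "gs \<in> lists G" "w = prod_list gs" unfolding B_def by blast
    then have "g * w \<in> B" unfolding B_def using g by (intro image_eqI[of _ _ "g # gs"]) auto
    then show ?case by (rule complex_vector.span_base)
  qed
  have "u \<in> complex_vector.span B" for u
  proof (induction u rule: D_induct)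
    case one
    have "1 \<in> B" unfolding B_def by (rule image_eqI[of _ _ "[]"]) auto
    then show ?case by (rule complex_vector.span_base)
  next
    case (ofA f u)
    show ?case
    proof (induction f rule: poly_mapping_lin_induct)
      case (single k c)
      have "ofA (Poly_Mapping.single k c) = c *\<^sub>C ofA (Poly_Mapping.single k 1)"
        by (simp add: scaleC_complex_def flip: ofA_scaleC)
      moreover have "ofA (Poly_Mapping.single k 1) * u \<in> complex_vector.span B"
        using ofA by (intro gen) (auto simp: G_def)
      ultimately show ?case by (simp add: D_scaleC_mult complex_vector.span_scale)
    next
      case (add f g)
      then show ?case by (simp add: ofA_add distrib_right complex_vector.span_add)
    qed
  next
    case (dD i u)
    then show ?case by (intro gen) (auto simp: G_def)
  next
    case (add u w)
    then show ?case by (rule complex_vector.span_add)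
  qed
  with \<open>countable B\<close> show ?thesis by blast
qed

definition x_var :: "'n \<Rightarrow> 'n A" where
  "x_var a = Poly_Mapping.single (0, Poly_Mapping.single a 1) 1"

lemma dA_x_var_mult: "dA i (x_var a * f) = (if i = a then f else 0) + x_var a * dA i f"
  by (simp add: dA_mult x_var_def dA_x del: One_nat_def)

lemma dA_x_var: "dA i (x_var a) = (if i = a then 1 else 0)"
  by (simp add: x_var_def dA_x del: One_nat_def)

lemma dA_1: "dA i 1 = 0"
  using dA_mult[of i 1 1] by simp

section \<open>Modules over \<open>\<gg>\<ll>\<^sub>n\<close>\<close>

lemma lie_moduleD:
  assumes "lie_module bracket act"
  shows "clinear (act x)" "clinear (\<lambda>x. act x v)"
    "act (bracket x y) v = act x (act y v) - act y (act x v)"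
  using assms by (simp_all add: lie_module_def cbilinear_def)

lemma matrix_eq_sum_matrix_unit: "X = (\<Sum>i\<in>UNIV. \<Sum>j\<in>UNIV. X $ i $ j *\<^sub>C matrix_unit i j)"
  unfolding vec_eq_iff
proof (intro allI)
  fix k l
  have "(\<Sum>i\<in>UNIV. \<Sum>j\<in>UNIV. X $ i $ j *\<^sub>C matrix_unit i j) $ k $ l
      = (\<Sum>i\<in>UNIV. \<Sum>j\<in>UNIV. if i = k then if j = l then X $ i $ j else 0 else 0)"
    by (auto simp: scaleC_vec_def matrix_unit_def scaleC_complex_def intro!: sum.cong)
  also have "\<dots> = (\<Sum>i\<in>UNIV. if i = k then \<Sum>j\<in>UNIV. if j = l then X $ i $ j else 0 else 0)"
    by (intro sum.cong) auto
  finally show "X $ k $ l = (\<Sum>i\<in>UNIV. \<Sum>j\<in>UNIV. X $ i $ j *\<^sub>C matrix_unit i j) $ k $ l"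
    by simp
qed

lemma gl_submoduleI:
  assumes "lie_module gl_bracket actV" "complex_vector.subspace W"
    and "\<And>i j w. w \<in> W \<Longrightarrow> actV (matrix_unit i j) w \<in> W"
  shows "submodule UNIV actV W"
  unfolding submodule_def
proof (intro conjI ballI)
  fix X w assume w: "w \<in> W"
  have "actV X w = (\<Sum>i\<in>UNIV. \<Sum>j\<in>UNIV. X $ i $ j *\<^sub>C actV (matrix_unit i j) w)"
    by (subst matrix_eq_sum_matrix_unit) (simp add: clinear_simps[OF lie_moduleD(2)[OF assms(1)]])
  also have "\<dots> \<in> W"
    by (intro complex_vector.subspace_sum[OF assms(2)] complex_vector.subspace_scale[OF assms(2)]
        assms(3) w)
  finally show "actV X w \<in> W" .
qed (rule assms(2))

text \<open>If the \<open>E\<^sub>i\<^sub>j\<close> act on \<open>\<And>(\<complex>\<^sup>n)\<close> as \<open>e\<^sub>i \<iota>\<^sub>j\<close> (wedging with \<open>e\<^sub>i\<close> after contracting with the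
  \<open>j\<close>-th coordinate), then \<open>E\<^sub>a\<^sub>j E\<^sub>b\<^sub>l - \<delta>\<^sub>j\<^sub>b E\<^sub>a\<^sub>l = - e\<^sub>a e\<^sub>b \<iota>\<^sub>j \<iota>\<^sub>l\<close> is antisymmetric in \<open>a\<close> and \<open>b\<close>. Its
  symmetrization, defined here for any operators \<open>E\<^sub>i\<^sub>j\<close>, therefore vanishes on exterior powers.\<close>

definition sym_normal_product :: "('n \<Rightarrow> 'n \<Rightarrow> 'w \<Rightarrow> 'w::ab_group_add) \<Rightarrow>
    'n \<Rightarrow> 'n \<Rightarrow> 'n \<Rightarrow> 'n \<Rightarrow> 'w \<Rightarrow> 'w" where
  "sym_normal_product E a b j l w =
     (E a j (E b l w) - (if j = b then E a l w else 0))
     + (E b j (E a l w) - (if j = a then E b l w else 0))"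

lemma clinear_sym_normal_product:
  assumes "\<And>i j. clinear (E i j)"
  shows "clinear (sym_normal_product E a b j l)"
  by (simp add: clinear_iff sym_normal_product_def clinear_simps[OF assms] scaleC_add_right
      complex_vector.scale_right_diff_distrib)

section \<open>Quadratic operators preserved by submodules of \<open>T(P, V)\<close>\<close>

definition left_act ::
  "('a \<Rightarrow> 'p::complex_vector \<Rightarrow> 'p) \<Rightarrow> 'a \<Rightarrow> ('p, 'v::complex_vector) tensor \<Rightarrow> ('p, 'v) tensor" where
  "left_act act u = tensor_map (act u) (\<lambda>v. v)"

definition right_act ::
  "('a \<Rightarrow> 'v::complex_vector \<Rightarrow> 'v) \<Rightarrow> 'a \<Rightarrow> ('p::complex_vector, 'v) tensor \<Rightarrow> ('p, 'v) tensor" where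
  "right_act act x = tensor_map (\<lambda>p. p) (act x)"

context
  fixes actP :: "'n::finite D \<Rightarrow> 'p::complex_vector \<Rightarrow> 'p"
    and actV :: "'n gl \<Rightarrow> 'v::complex_vector \<Rightarrow> 'v"
  assumes P: "algebra_module actP" and V: "lie_module gl_bracket actV"
begin

private abbreviation (input) "U \<equiv> (left_act actP :: 'n D \<Rightarrow> ('p, 'v) tensor \<Rightarrow> ('p, 'v) tensor)"
private abbreviation (input) "E_T i j \<equiv> (right_act actV (matrix_unit i j) :: ('p, 'v) tensor \<Rightarrow> ('p, 'v) tensor)"
private abbreviation (input) "L f j \<equiv> T_act actP actV (axis j f)"

private lemmas P_simps = clinear_simps[OF algebra_moduleD(1)[OF P]]
  clinear_simps[OF algebra_moduleD(2)[OF P]] algebra_moduleD(3,4)[OF P]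

lemma clinear_left_act: "clinear (U u)"
  and clinear_right_act: "clinear (E_T i j)"
  by (simp_all add: left_act_def right_act_def clinear_tensor_map algebra_moduleD[OF P] lie_moduleD[OF V])

lemma clinear_T_axis: "clinear (L f j)"
  by (rule lie_moduleD(1)[OF T_lie_module[OF P V]])

lemma left_act_tens: "U u (p \<otimes>\<^sub>C v) = actP u p \<otimes>\<^sub>C v"
  and right_act_tens: "E_T i j (p \<otimes>\<^sub>C v) = p \<otimes>\<^sub>C actV (matrix_unit i j) v"
  by (simp_all add: left_act_def right_act_def tensor_map_tens algebra_moduleD[OF P] lie_moduleD[OF V])

lemma left_act_mult: "U (u * w) t = U u (U w t)"
  by (rule clinear_eq_on_tens[of "U (u * w)" "\<lambda>t. U u (U w t)"])
    (simp_all add: left_act_tens clinear_left_act clinear_compose P_simps)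

lemma left_act_add: "U (u + w) t = U u t + U w t"
  by (rule clinear_eq_on_tens[of "U (u + w)" "\<lambda>t. U u t + U w t"])
    (simp_all add: left_act_tens clinear_left_act clinear_add P_simps tens_lin)

lemma left_act_diff: "U (u - w) t = U u t - U w t"
  by (rule clinear_eq_on_tens[of "U (u - w)" "\<lambda>t. U u t - U w t"])
    (simp_all add: left_act_tens clinear_left_act clinear_diff P_simps tensL)

lemma left_act_one: "U 1 t = t"
  by (rule clinear_eq_on_tens[of "U 1" "\<lambda>t. t"]) (simp_all add: left_act_tens clinear_left_act P_simps)

lemma left_act_zero: "U 0 t = 0"
  using left_act_diff[of 0 0] by simp

lemma right_act_left_act: "E_T i j (U u t) = U u (E_T i j t)"
  by (rule clinear_eq_on_tens[of "\<lambda>t. E_T i j (U u t)" "\<lambda>t. U u (E_T i j t)"])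
    (simp_all add: right_act_tens left_act_tens clinear_left_act clinear_right_act clinear_compose)

lemma T_axis_tens: "L f j (p \<otimes>\<^sub>C v) = actP (ofA f * dD j) p \<otimes>\<^sub>C v
   + (\<Sum>i\<in>UNIV. actP (ofA (dA i f)) p \<otimes>\<^sub>C actV (matrix_unit i j) v)"
proof -
  let ?b = "\<lambda>X p v. \<Sum>j\<in>UNIV. actP (ofA (X $ j) * dD j) p \<otimes>\<^sub>C v
       + (\<Sum>i\<in>UNIV. actP (ofA (dA i (X $ j))) p \<otimes>\<^sub>C actV (matrix_unit i j) v)"
  have "cbilinear (?b X)" for X
    unfolding cbilinear_def clinear_iff
    by (simp add: P_simps clinear_simps[OF lie_moduleD(1)[OF V]] tens_lin sum.distrib
        complex_vector.scale_sum_right scaleC_add_right)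
  then have "L f j (p \<otimes>\<^sub>C v) = ?b (axis j f) p v"
    unfolding T_act_def by (rule tensor_lift_tens)
  also have "\<dots> = (\<Sum>k\<in>UNIV. if k = j then actP (ofA f * dD j) p \<otimes>\<^sub>C v
       + (\<Sum>i\<in>UNIV. actP (ofA (dA i f)) p \<otimes>\<^sub>C actV (matrix_unit i j) v) else 0)"
  proof (rule sum.cong[OF refl])
    fix k
    show "actP (ofA (axis j f $ k) * dD k) p \<otimes>\<^sub>C v
       + (\<Sum>i\<in>UNIV. actP (ofA (dA i (axis j f $ k))) p \<otimes>\<^sub>C actV (matrix_unit i k) v)
      = (if k = j then actP (ofA f * dD j) p \<otimes>\<^sub>C v
       + (\<Sum>i\<in>UNIV. actP (ofA (dA i f)) p \<otimes>\<^sub>C actV (matrix_unit i j) v) else 0)"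
      by (simp add: axis_def P_simps ofA_0 tens_0 clinear_simps(3)[OF clinear_dA])
  qed
  finally show ?thesis by simp
qed

lemma T_axis_1: "L 1 j t = U (dD j) t"
proof (rule clinear_eq_on_tens[OF clinear_T_axis clinear_left_act])
  show "L 1 j (p \<otimes>\<^sub>C v) = U (dD j) (p \<otimes>\<^sub>C v)" for p v
    by (simp add: T_axis_tens left_act_tens dA_1 ofA_one ofA_0 tens_0 P_simps)
qed

text \<open>Multiplying the coefficient of a vector field by \<open>x\<^sub>a\<close> is almost the same as first acting
  by \<open>x\<^sub>a\<close> on the left factor; the defect has no derivative in it.\<close>

lemma T_axis_x_var_mult:
  "L (x_var a * f) j t
     = L f j (U (ofA (x_var a)) t) + U (ofA f) (E_T a j t - (if j = a then t else 0))"
proof (rule clinear_eq_on_tens[OF clinear_T_axis])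
  have "clinear (\<lambda>t :: ('p, 'v) tensor. if j = a then t else 0)" by (simp add: clinear_iff)
  then show "clinear (\<lambda>t. L f j (U (ofA (x_var a)) t) + U (ofA f) (E_T a j t - (if j = a then t else 0)))"
    by (intro clinear_add clinear_diff clinear_compose[OF clinear_T_axis] clinear_compose[OF clinear_left_act]
        clinear_left_act clinear_right_act)
  fix p v
  let ?E = "\<lambda>i. actV (matrix_unit i j) v"
  have "ofA (x_var a * f) * dD j = ofA f * dD j * ofA (x_var a) - ofA f * ofA (dA j (x_var a))"
    by (simp add: mult.commute[of "x_var a"] ofA_mult mult.assoc d_move distrib_left)
  then have "actP (ofA (x_var a * f) * dD j) p \<otimes>\<^sub>C v
     = actP (ofA f * dD j) (actP (ofA (x_var a)) p) \<otimes>\<^sub>C v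
       - (if j = a then actP (ofA f) p \<otimes>\<^sub>C v else 0)"
    by (simp add: dA_x_var P_simps tensL ofA_one ofA_0 tens_0)
  moreover have "(\<Sum>i\<in>UNIV. actP (ofA (dA i (x_var a * f))) p \<otimes>\<^sub>C ?E i)
     = (\<Sum>i\<in>UNIV. (if i = a then actP (ofA f) p \<otimes>\<^sub>C ?E i else 0)
         + actP (ofA (dA i f)) (actP (ofA (x_var a)) p) \<otimes>\<^sub>C ?E i)"
  proof (rule sum.cong[OF refl])
    fix i
    show "actP (ofA (dA i (x_var a * f))) p \<otimes>\<^sub>C ?E i
      = (if i = a then actP (ofA f) p \<otimes>\<^sub>C ?E i else 0)
         + actP (ofA (dA i f)) (actP (ofA (x_var a)) p) \<otimes>\<^sub>C ?E i"
      unfolding dA_x_var_mult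
      by (simp add: mult.commute[of "x_var a"] ofA_add ofA_mult P_simps tens_lin ofA_0 tens_0)
  qed
  ultimately show "L (x_var a * f) j (p \<otimes>\<^sub>C v) = L f j (U (ofA (x_var a)) (p \<otimes>\<^sub>C v))
       + U (ofA f) (E_T a j (p \<otimes>\<^sub>C v) - (if j = a then p \<otimes>\<^sub>C v else 0))"
    by (simp add: T_axis_tens left_act_tens right_act_tens sum.distrib clinear_simps[OF clinear_left_act])
qed

lemma T_axis_x_var: "L (x_var b) l t = U (ofA (x_var b)) (U (dD l) t) + E_T b l t"
proof -
  have "L (x_var b) l t = U (dD l * ofA (x_var b)) t + (E_T b l t - (if l = b then t else 0))"
    using T_axis_x_var_mult[of l b 1 t] by (simp add: T_axis_1 ofA_one left_act_one left_act_mult)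
  also have "dD l * ofA (x_var b) = ofA (x_var b) * dD l + (if l = b then 1 else 0)"
    by (simp add: d_move dA_x_var ofA_one ofA_0)
  finally show ?thesis by (simp add: left_act_add left_act_mult left_act_one left_act_zero)
qed

lemma T_axis_x_var_x_var:
  "L (x_var a * x_var b) l t = U (ofA (x_var b)) (U (ofA (x_var a)) (U (dD l) t))
     + U (ofA (x_var a)) (E_T b l t) + U (ofA (x_var b)) (E_T a l t)"
proof -
  have comm: "dD l * ofA (x_var a) = ofA (x_var a) * dD l + (if l = a then 1 else 0)"
    by (simp add: d_move dA_x_var ofA_one ofA_0)
  have "U (dD l) (U (ofA (x_var a)) t) = U (ofA (x_var a)) (U (dD l) t) + (if l = a then t else 0)"
    by (simp add: left_act_add left_act_one left_act_zero comm flip: left_act_mult)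
  then show ?thesis
    by (simp add: T_axis_x_var_mult T_axis_x_var right_act_left_act clinear_simps[OF clinear_left_act])
qed

text \<open>Composing two elements of \<open>\<gg>\<^sub>n\<close> gives a bidifferential operator of total order at most
  two in their coefficients \<open>f\<close> and \<open>g\<close>. It is applied here to
  \<open>(x\<^sub>a \<otimes> 1 - 1 \<otimes> x\<^sub>a) (x\<^sub>b \<otimes> 1 - 1 \<otimes> x\<^sub>b) (h \<otimes> 1)\<close> in \<open>A\<^sub>n \<otimes> A\<^sub>n\<close>; the vanishing of this tensor
  to second order on the diagonal leaves only the top order part, in which no derivative acts
  on \<open>P\<close>.\<close>

lemma quadratic_identity:
  "L (x_var a * (x_var b * h)) j (L 1 l t) - L (x_var a * h) j (L (x_var b) l t)
     - L (x_var b * h) j (L (x_var a) l t) + L h j (L (x_var a * x_var b) l t)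
   = - U (ofA h) (sym_normal_product E_T a b j l t)"
proof -
  have comm: "U (ofA f) (U (ofA g) s) = U (ofA g) (U (ofA f) s)" for f g s
    by (simp add: mult.commute flip: left_act_mult ofA_mult)
  have hx: "U (ofA (x_var b * h)) s = U (ofA h) (U (ofA (x_var b)) s)" for s
    by (simp add: mult.commute[of "x_var b"] ofA_mult left_act_mult)
  note lin = clinear_simps[OF clinear_T_axis] clinear_simps[OF clinear_left_act] clinear_simps[OF clinear_right_act]
  show ?thesis
    unfolding T_axis_x_var_x_var T_axis_1 T_axis_x_var
    unfolding T_axis_x_var_mult sym_normal_product_def
    by (simp add: lin right_act_left_act hx comm[of "x_var b" "x_var a"])
qed

text \<open>The factor \<open>h\<close> in the quadratic identity is an arbitrary element of \<open>A\<^sub>n\<close>, and \<open>d\<^sub>m \<in> \<gg>\<^sub>n\<close>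
  acts on the left factor only. Together they give all of \<open>D\<^sub>n\<close> there.\<close>

lemma submodule_quadratic:
  assumes M: "submodule UNIV (T_act actP actV) M" and t: "t \<in> M"
  shows "U u (sym_normal_product E_T a b j l t) \<in> M"
proof -
  have L: "L f i s \<in> M" if "s \<in> M" for f i s
    using M that unfolding submodule_def by blast
  have sub: "complex_vector.subspace M" using M unfolding submodule_def by blast
  let ?q = "sym_normal_product E_T a b j l t"
  note closed = complex_vector.subspace_add[OF sub] complex_vector.subspace_diff[OF sub]
    complex_vector.subspace_neg[OF sub]
  \<comment> \<open>The factor \<open>ofA h\<close> is carried along since \<open>M\<close> need not be stable under \<open>A\<^sub>n\<close>.\<close>
  have "U (ofA h * u) ?q \<in> M" for h
  proof (induction u arbitrary: h rule: D_induct)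
    case one
    have "- U (ofA h) ?q \<in> M"
      unfolding quadratic_identity[symmetric] by (intro closed L t)
    then have "- (- U (ofA h) ?q) \<in> M" by (rule closed)
    then show ?case by simp
  next
    case (ofA f u)
    then show ?case by (metis mult.assoc ofA_mult)
  next
    case (dD i u)
    have "ofA h * (dD i * u) = dD i * (ofA h * u) - ofA (dA i h) * u"
      by (simp add: d_move distrib_right flip: mult.assoc)
    moreover have "U (dD i * (ofA h * u)) ?q \<in> M"
      using L[OF dD] by (simp add: left_act_mult[of "dD i"] flip: T_axis_1)
    ultimately show ?case by (simp add: left_act_diff closed dD)
  next
    case (add u w)
    then show ?case by (simp add: distrib_left left_act_add closed)
  qed
  from this[of 1] show ?thesis by (simp add: ofA_one)
qed

text \<open>The largest \<open>D\<^sub>n\<close>-stable subspace \<open>N\<close> of a \<open>\<gg>\<^sub>n\<close>-submodule \<open>M\<close> is stable under \<open>\<gg>\<ll>\<^sub>n\<close> acting on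
  \<open>V\<close>, because \<open>1 \<otimes> E\<^sub>i\<^sub>j\<close> is the difference between the actions of \<open>x\<^sub>i d\<^sub>j\<close> on \<open>T(P, V)\<close> and on the
  left factor alone. As \<open>P \<otimes> V\<close> is simple over the two algebras together, \<open>N = 0\<close> for proper
  \<open>M\<close>. But \<open>N\<close> contains the image of \<open>M\<close> under the symmetrized products, so these vanish on \<open>M\<close>,
  and then on the contraction to \<open>V\<close> of any element of \<open>M\<close>.\<close>

lemma reducible_imp_sym_normal_product_eq_0:
  assumes simpleP: "simple_module UNIV actP" and simpleV: "simple_module UNIV actV"
    and "reducible_module UNIV (T_act actP actV)"
  shows "\<exists>v\<noteq>0. \<forall>a b j l. sym_normal_product (\<lambda>i j. actV (matrix_unit i j)) a b j l v = 0"
proof -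
  obtain M where M: "submodule UNIV (T_act actP actV) M" "M \<noteq> {0}" "M \<noteq> UNIV"
    using assms(3) unfolding reducible_module_def by blast
  have sub: "complex_vector.subspace M" using M(1) unfolding submodule_def by blast
  note linE = lie_moduleD(1)[OF V]
  define N where "N = {t. \<forall>u. U u t \<in> M}"
  have NM: "N \<subseteq> M" using left_act_one unfolding N_def by (metis (lifting) mem_Collect_eq subsetI)
  have sub_N: "complex_vector.subspace N"
    using sub by (simp add: N_def complex_vector.subspace_def clinear_simps[OF clinear_left_act])
  have U_N: "U u t \<in> N" if "t \<in> N" for u t
    using that by (simp add: N_def flip: left_act_mult)
  have E_N: "E_T i j t \<in> N" if t: "t \<in> N" for i j t
    unfolding N_def
  proof (intro CollectI allI)
    fix u
    let ?s = "U u t"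
    have s: "?s \<in> N" using t by (rule U_N)
    have "L (x_var i) j ?s \<in> M"
      using M(1) s NM unfolding submodule_def by blast
    moreover have "U (ofA (x_var i)) (U (dD j) ?s) \<in> M" using U_N[OF U_N[OF s]] NM by blast
    ultimately have "L (x_var i) j ?s - U (ofA (x_var i)) (U (dD j) ?s) \<in> M"
      by (rule complex_vector.subspace_diff[OF sub])
    then show "U u (E_T i j t) \<in> M" by (simp add: T_axis_x_var right_act_left_act)
  qed
  define actE where "actE = (\<lambda>(i, j). actV (matrix_unit i j))"
  \<comment> \<open>\<open>N\<close> is only known to be stable under the matrix units, so simplicity of \<open>V\<close> is transferred to these.\<close>
  have simpleE: "simple_module UNIV actE"
    unfolding simple_module_def
  proof (intro conjI allI impI)
    show "(UNIV :: 'v set) \<noteq> {0}" using simpleV unfolding simple_module_def by blast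
    fix W assume "submodule UNIV actE W"
    then have "submodule UNIV actV W"
      by (intro gl_submoduleI[OF V]) (auto simp: submodule_def actE_def)
    then show "W = {0} \<or> W = UNIV" using simpleV unfolding simple_module_def by blast
  qed
  obtain B where B: "countable B" "complex_vector.span B = (UNIV :: 'n D set)"
    using D_countable_dim by blast
  have "N = {0}"
  proof (rule ccontr)
    assume "N \<noteq> {0}"
    have "N = UNIV"
    proof (rule simple_outer_tensor[OF P simpleP B _ simpleE sub_N U_N[unfolded left_act_def]])
      show "clinear (actE x)" for x by (simp add: actE_def linE split: prod.split)
      show "tensor_map (\<lambda>p. p) (actE x) t \<in> N" if "t \<in> N" for x t
        using E_N[OF that] by (cases x) (simp add: actE_def right_act_def)
    qed (use \<open>N \<noteq> {0}\<close> in auto)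
    with NM M(3) show False by blast
  qed
  have zero: "sym_normal_product E_T a b j l t = 0" if "t \<in> M" for a b j l t
    using submodule_quadratic[OF M(1) that] \<open>N = {0}\<close> unfolding N_def by blast
  have "\<exists>t. t \<in> M \<and> t \<noteq> 0" using M(2) complex_vector.subspace_0[OF sub] by auto
  then obtain t where t: "t \<in> M" "t \<noteq> 0" by blast
  obtain \<phi> :: "'p \<Rightarrow> complex" where \<phi>: "clinear \<phi>" "contract_left \<phi> t \<noteq> 0"
    using contract_left_nonzero[OF t(2)] by blast
  note lin = clinear_simps[OF clinear_contract_left[OF \<phi>(1)]]
  have "sym_normal_product (\<lambda>i j. actV (matrix_unit i j)) a b j l (contract_left \<phi> t)
      = contract_left \<phi> (sym_normal_product E_T a b j l t)" for a b j l
    by (simp add: sym_normal_product_def lin right_act_def contract_left_tensor_map[OF \<phi>(1) linE])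
  then show ?thesis using \<phi>(2) zero[OF t(1)] lin(3) by (intro exI[of _ "contract_left \<phi> t"]) simp
qed

end

section \<open>\<open>\<gg>\<ll>\<^sub>n\<close>-modules killed by the symmetrized normal ordered products\<close>

lemma initial_segment_nat:
  assumes "finite (A :: nat set)" "\<And>i j. j \<in> A \<Longrightarrow> i < j \<Longrightarrow> i \<in> A"
  shows "A = {..<card A}"
proof -
  obtain m where m: "m \<notin> A" using assms(1) ex_new_if_finite infinite_UNIV_nat by blast
  define k where "k = (LEAST k. k \<notin> A)"
  have k: "k \<notin> A" "\<And>i. i < k \<Longrightarrow> i \<in> A"
    unfolding k_def using LeastI[of "\<lambda>k. k \<notin> A", OF m] not_less_Least[of _ "\<lambda>k. k \<notin> A"] by blast+
  then have "A = {..<k}" using assms(2) by (metis lessThan_iff linorder_neqE_nat subsetI subset_antisym)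
  then show ?thesis by simp
qed

context
  fixes actV :: "'n::{finite, linorder} gl \<Rightarrow> 'v::complex_vector \<Rightarrow> 'v"
  assumes V: "lie_module gl_bracket actV" and simpleV: "simple_module UNIV actV"
begin

private abbreviation (input) "E i j \<equiv> actV (matrix_unit i j)"

private lemmas linV = clinear_simps[OF lie_moduleD(1)[OF V]]
private lemmas linX = clinear_simps[OF lie_moduleD(2)[OF V]]

lemma matrix_unit_commute:
  "E i j (E k l v) = E k l (E i j v) + (if j = k then E i l v else 0) - (if l = i then E k j v else 0)"
proof -
  have "E i j (E k l v) - E k l (E i j v) = actV (gl_bracket (matrix_unit i j) (matrix_unit k l)) v"
    by (simp add: lie_moduleD(3)[OF V])
  also have "\<dots> = (if j = k then E i l v else 0) - (if l = i then E k j v else 0)"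
    by (simp add: gl_bracket_def matrix_unit_mult linX)
  finally show ?thesis by (simp add: algebra_simps)
qed

text \<open>The symmetrized products transform under \<open>\<gg>\<ll>\<^sub>n\<close> like a tensor with upper indices \<open>a\<close>, \<open>b\<close>
  and lower indices \<open>j\<close>, \<open>l\<close>; hence their common kernel is a submodule.\<close>

lemma sym_normal_product_equivariant:
  "sym_normal_product E a b j l (E p q v) = E p q (sym_normal_product E a b j l v)
     - (if q = a then sym_normal_product E p b j l v else 0)
     - (if q = b then sym_normal_product E a p j l v else 0)
     + (if j = p then sym_normal_product E a b q l v else 0)
     + (if l = p then sym_normal_product E a b j q v else 0)"
proof -
  \<comment> \<open>With the Kronecker deltas as scalars, the claim is a bilinear identity.\<close>
  define d where "d x y = (if x = y then 1 else 0 :: complex)" for x y :: 'n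
  have d: "(if x = y then w else 0) = d x y *\<^sub>C w" for x y and w :: 'v
    by (simp add: d_def scaleC_one)
  have comm: "E i j (E p q w) = E p q (E i j w) + d j p *\<^sub>C E i q w - d q i *\<^sub>C E p j w" for i j w
    by (subst matrix_unit_commute) (simp only: d)
  show ?thesis
    unfolding sym_normal_product_def d
    by (simp add: comm linV scaleC_add_right complex_vector.scale_right_diff_distrib scaleC_scaleC
        mult.commute algebra_simps)
qed

lemma sym_normal_product_eq_0:
  assumes "v \<noteq> 0" "\<And>a b j l. sym_normal_product E a b j l v = 0"
  shows "sym_normal_product E a b j l w = 0"
proof -
  let ?W = "{v. \<forall>a b j l. sym_normal_product E a b j l v = 0}"
  have "submodule UNIV actV ?W"
  proof (rule gl_submoduleI[OF V])
    show "complex_vector.subspace ?W"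
      by (simp add: complex_vector.subspace_def
          clinear_simps[OF clinear_sym_normal_product[OF lie_moduleD(1)[OF V]]])
    show "E i j w \<in> ?W" if "w \<in> ?W" for i j w
      using that by (simp add: sym_normal_product_equivariant linV)
  qed
  moreover have "v \<in> ?W" using assms by simp
  ultimately have "?W = UNIV" using simpleV assms(1) unfolding simple_module_def by blast
  then show ?thesis by blast
qed

context
  assumes quad: "\<And>a b j l v. sym_normal_product E a b j l v = 0"
begin

lemma diag_matrix_unit: "E a a (E a l v) = E a l v"
proof -
  have "2 *\<^sub>C (E a a (E a l v) - E a l v) = 0"
    using quad[of a a a l v]
    by (simp add: sym_normal_product_def scaleC_one complex_vector.scale_left_distrib[of 1 1, simplified])
  then show ?thesis by simp
qed

text \<open>The \<open>E\<^sub>a\<^sub>a\<close> are commuting idempotents, so a weight of \<open>\<gg>\<ll>\<^sub>n\<close> is given by the set \<open>S\<close> of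
  those \<open>a\<close> for which \<open>E\<^sub>a\<^sub>a\<close> has eigenvalue \<open>1\<close>.\<close>

definition weight_vector :: "'n set \<Rightarrow> 'v \<Rightarrow> bool" where
  "weight_vector S v \<longleftrightarrow> v \<noteq> 0 \<and> (\<forall>a. E a a v = (if a \<in> S then v else 0))"

lemma weight_vector_exists: "\<exists>S v. weight_vector S v"
proof -
  have "\<exists>v\<noteq>0. \<forall>a\<in>K. E a a v = v \<or> E a a v = 0" if "finite K" for K
    using that
  proof induction
    case empty
    show ?case using simpleV unfolding simple_module_def by blast
  next
    case (insert x K)
    then obtain v where v: "v \<noteq> 0" "\<And>a. a \<in> K \<Longrightarrow> E a a v = v \<or> E a a v = 0" by blast
    show ?case
    proof (cases "E x x v = 0")
      case True
      with v show ?thesis by (intro exI[of _ v]) auto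
    next
      case False
      have "E a a (E x x v) = E x x v \<or> E a a (E x x v) = 0" if a: "a \<in> insert x K" for a
      proof (cases "a = x")
        case True
        then show ?thesis by (simp add: diag_matrix_unit)
      next
        case False
        have "E a a (E x x v) = E x x (E a a v)"
          by (subst matrix_unit_commute) auto
        moreover have "E a a v = v \<or> E a a v = 0" using a False by (intro v(2)) simp
        ultimately show ?thesis by (elim disjE) (simp_all only: linV(3) simp_thms)
      qed
      with False show ?thesis by (intro exI[of _ "E x x v"]) simp
    qed
  qed
  from this[of UNIV] obtain v where "v \<noteq> 0" "\<And>a. E a a v = v \<or> E a a v = 0" by auto
  then have "weight_vector {a. E a a v = v} v" by (auto simp: weight_vector_def)
  then show ?thesis by blast
qed

text \<open>For \<open>i \<noteq> j\<close>, \<open>E\<^sub>i\<^sub>j\<close> raises the eigenvalue of \<open>E\<^sub>i\<^sub>i\<close> and lowers that of \<open>E\<^sub>j\<^sub>j\<close> by one, but both stay in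
  \<open>{0, 1}\<close>.\<close>

lemma weight_vector_raise:
  assumes v: "weight_vector S v" and "i \<noteq> j" and nz: "E i j v \<noteq> 0"
  shows "i \<notin> S" "j \<in> S" "weight_vector (insert i (S - {j})) (E i j v)"
proof -
  let ?w = "E i j v"
  have act: "E k k ?w = (if k \<in> S then ?w else 0) + (if k = i then ?w else 0) - (if j = k then ?w else 0)"
    for k
    using v by (subst matrix_unit_commute) (auto simp: weight_vector_def linV)
  have idem: "E k k (E k k u) = E k k u" for k u by (rule diag_matrix_unit)
  show i: "i \<notin> S"
    using act[of i] diag_matrix_unit[of i j v] \<open>i \<noteq> j\<close> nz by auto
  show j: "j \<in> S"
  proof (rule ccontr)
    assume "j \<notin> S"
    then have minus: "E j j ?w = - ?w" using act[of j] \<open>i \<noteq> j\<close> by simp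
    then have "?w = - ?w" using idem[of j ?w] by (simp add: linV)
    then have "2 *\<^sub>C ?w = 0"
      by (metis add.right_inverse complex_vector.scale_left_distrib one_add_one scaleC_one)
    then show False using nz by simp
  qed
  show "weight_vector (insert i (S - {j})) ?w"
    unfolding weight_vector_def using nz act i j \<open>i \<noteq> j\<close> by auto
qed

text \<open>One of the relations is \<open>E\<^sub>j\<^sub>i E\<^sub>i\<^sub>j = E\<^sub>j\<^sub>j - E\<^sub>i\<^sub>i E\<^sub>j\<^sub>j\<close>, and the right-hand side acts as \<open>1\<close> if \<open>i \<notin> S\<close>
  and \<open>j \<in> S\<close>.\<close>

lemma weight_vector_raise_nonzero:
  assumes v: "weight_vector S v" and "i \<notin> S" "j \<in> S"
  shows "E i j v \<noteq> 0"
proof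
  assume z: "E i j v = 0"
  have "i \<noteq> j" using assms by auto
  have "E j j v = v" "E i i v = 0" using assms by (auto simp: weight_vector_def)
  then show False
    using quad[of j i i j v] z v \<open>i \<noteq> j\<close>
    by (simp add: sym_normal_product_def linV weight_vector_def)
qed

text \<open>For \<open>i < j\<close>, \<open>E\<^sub>i\<^sub>j\<close> replaces \<open>j\<close> by \<open>i\<close> in the weight \<open>S\<close>. So a weight vector whose \<open>S\<close> has
  the smallest sum of positions is a highest weight vector, and as the replacement is possible
  whenever \<open>i \<notin> S\<close> and \<open>j \<in> S\<close>, its \<open>S\<close> is an initial segment.\<close>

lemma highest_weight_exists:
  "\<exists>S v. weight_vector S v \<and> (\<forall>i j. i < j \<longrightarrow> E i j v = 0) \<and> (\<forall>j\<in>S. \<forall>i<j. i \<in> S)"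
proof -
  define pos where "pos k = card {..<k}" for k :: 'n
  have pos: "pos i < pos j" if "i < j" for i j
    unfolding pos_def using that by (intro psubset_card_mono) auto
  obtain S0 v0 where "weight_vector S0 v0" using weight_vector_exists by blast
  then obtain S v where Sv: "weight_vector S v"
    and min: "\<And>S' v'. weight_vector S' v' \<Longrightarrow> sum pos S \<le> sum pos S'"
    using ex_has_least_nat[of "\<lambda>(S, v). weight_vector S v" "(S0, v0)" "\<lambda>(S, v). sum pos S"]
    by auto
  have hw: "E i j v = 0" if ij: "i < j" for i j
  proof (rule ccontr)
    assume "E i j v \<noteq> 0"
    note * = weight_vector_raise[OF Sv less_imp_neq[OF ij] this]
    have "sum pos (insert i (S - {j})) + pos j = pos i + sum pos S"
      using * ij by (simp add: sum.remove[of S j])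
    then show False using min[OF *(3)] pos[OF ij] ij by simp
  qed
  moreover have "i \<in> S" if "j \<in> S" "i < j" for i j
    using weight_vector_raise_nonzero[OF Sv _ that(1)] hw[OF that(2)] by blast
  ultimately show ?thesis using Sv by blast
qed

lemma nth_index_initial_segment:
  assumes "\<forall>j\<in>S. \<forall>i<j. i \<in> (S :: 'n set)" "k < CARD('n)"
  shows "nth_index (Suc k) \<in> S \<longleftrightarrow> k < card S"
proof -
  let ?xs = "sorted_list_of_set (UNIV :: 'n set)"
  have len: "length ?xs = CARD('n)" by simp
  have sorted: "?xs ! i < ?xs ! j" if "i < j" "j < CARD('n)" for i j
    using sorted_wrt_nth_less[OF strict_sorted_list_of_set] that len by metis
  define A where "A = {k. k < CARD('n) \<and> ?xs ! k \<in> S}"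
  have "A = {..<card A}"
  proof (rule initial_segment_nat)
    show "finite A" unfolding A_def by simp
    fix i j assume "j \<in> A" "i < j"
    then show "i \<in> A" using assms(1) sorted unfolding A_def by auto
  qed
  moreover have "bij_betw ((!) ?xs) A S"
  proof (rule bij_betw_imageI)
    show "inj_on ((!) ?xs) A"
      using distinct_sorted_list_of_set[of "UNIV :: 'n set"]
      by (auto simp: A_def inj_on_def nth_eq_iff_index_eq)
    show "(!) ?xs ` A = S"
    proof
      show "S \<subseteq> (!) ?xs ` A"
      proof
        fix s assume "s \<in> S"
        moreover have "s \<in> set ?xs" by simp
        then obtain k where "k < CARD('n)" "?xs ! k = s" by (metis in_set_conv_nth len)
        ultimately show "s \<in> (!) ?xs ` A" unfolding A_def by blast
      qed
    qed (auto simp: A_def)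
  qed
  then have "card A = card S" by (rule bij_betw_same_card)
  ultimately have "k \<in> A \<longleftrightarrow> k < card S" by auto
  then show ?thesis using assms(2) by (simp add: A_def nth_index_def)
qed

text \<open>The highest weight \<open>S = {1, \<dots>, r}\<close> restricts to \<open>\<delta>\<^sub>r\<close>. The identity matrix is central, so it acts
  everywhere by the scalar \<open>r\<close> by which it acts on the highest weight vector; consequently
  \<open>\<ss>\<ll>\<^sub>n\<close>-submodules are \<open>\<gg>\<ll>\<^sub>n\<close>-submodules.\<close>

lemma iso_V_delta_if_sym_normal_product_eq_0: "\<exists>r\<in>{0..CARD('n)}. iso_V_delta r actV"
proof -
  obtain S v where Sv: "weight_vector S v" and hw: "\<And>i j. i < j \<Longrightarrow> E i j v = 0"
    and seg: "\<forall>j\<in>S. \<forall>i<j. i \<in> S"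
    using highest_weight_exists by blast
  let ?r = "card S"
  have v: "v \<noteq> 0" "\<And>a. E a a v = (if a \<in> S then v else 0)"
    using Sv by (auto simp: weight_vector_def)
  have "mat 1 = (\<Sum>i\<in>UNIV. matrix_unit i i :: 'n gl)"
    by (auto simp: vec_eq_iff mat_def matrix_unit_def intro!: sum.neutral)
  then have "actV (mat 1) v = (\<Sum>i\<in>UNIV. if i \<in> S then v else 0)"
    by (simp add: linX v(2))
  also have "\<dots> = of_nat ?r *\<^sub>C v"
    by (simp add: sum.If_cases complex_vector.sum_constant_scale)
  finally have mat_v: "actV (mat 1) v = of_nat ?r *\<^sub>C v" .
  have "submodule UNIV actV {w. actV (mat 1) w = of_nat ?r *\<^sub>C w}"
    unfolding submodule_def
  proof (intro conjI ballI)
    show "complex_vector.subspace {w. actV (mat 1) w = of_nat ?r *\<^sub>C w}"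
      by (simp add: complex_vector.subspace_def linV scaleC_add_right scaleC_scaleC mult.commute)
    fix X w assume w: "w \<in> {w. actV (mat 1) w = of_nat ?r *\<^sub>C w}"
    have "actV (gl_bracket (mat 1) X) w = 0" by (simp add: gl_bracket_def linX)
    then show "actV X w \<in> {w. actV (mat 1) w = of_nat ?r *\<^sub>C w}"
      using w by (simp add: lie_moduleD(3)[OF V] linV)
  qed
  moreover have "v \<in> {w. actV (mat 1) w = of_nat ?r *\<^sub>C w}" using mat_v by simp
  ultimately have "{w. actV (mat 1) w = of_nat ?r *\<^sub>C w} = UNIV"
    using simpleV v(1) unfolding simple_module_def by blast
  then have scalar: "actV (mat 1) w = of_nat ?r *\<^sub>C w" for w by blast
  have "simple_module sl actV"
    unfolding simple_module_def
  proof (intro conjI allI impI)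
    show "(UNIV :: 'v set) \<noteq> {0}" using simpleV unfolding simple_module_def by blast
    fix W assume W: "submodule sl actV W"
    then have sub: "complex_vector.subspace W" by (simp add: submodule_def)
    have "actV X w \<in> W" if w: "w \<in> W" for X w
    proof -
      \<comment> \<open>\<open>X - c 1\<close> is the component of \<open>X\<close> in \<open>\<ss>\<ll>\<^sub>n\<close>\<close>
      define c where "c = trace X / of_nat CARD('n)"
      have "trace (X - c *\<^sub>C mat 1) = 0"
        by (simp add: trace_def sum_subtractf scaleC_vec_def mat_def scaleC_complex_def c_def)
      then have "actV (X - c *\<^sub>C mat 1) w \<in> W"
        using W w unfolding submodule_def sl_def by blast
      then have "actV (X - c *\<^sub>C mat 1) w + c *\<^sub>C of_nat ?r *\<^sub>C w \<in> W"
        using w sub by (intro complex_vector.subspace_add complex_vector.subspace_scale)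
      then show ?thesis by (simp add: linX scalar)
    qed
    then have "submodule UNIV actV W" using sub by (simp add: submodule_def)
    then show "W = {0} \<or> W = UNIV" using simpleV unfolding simple_module_def by blast
  qed
  moreover have "highest_weight_vector (delta_weight ?r) actV v"
    unfolding highest_weight_vector_def
  proof (intro conjI ballI allI impI)
    fix j assume j: "j \<in> {1..<CARD('n)}"
    then obtain k where k: "j = Suc k" "Suc k < CARD('n)" by (cases j) auto
    show "actV (coroot j) v = delta_weight ?r j *\<^sub>C v"
      using nth_index_initial_segment[OF seg, of k] nth_index_initial_segment[OF seg, of "Suc k"] k
      by (auto simp: coroot_def linX v(2) delta_weight_def scaleC_one)
  qed (use v hw in auto)
  ultimately have "iso_V_delta ?r actV"
    unfolding iso_V_delta_def sl_simple_highest_weight_def using V simpleV scalar by blast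
  moreover have "?r \<le> CARD('n)" by (simp add: card_mono)
  ultimately show ?thesis by auto
qed

end

end

section \<open>Reducible modules \<open>T(P, V)\<close>\<close>

theorem theorem3p1:
  fixes actP :: "'n::{finite, linorder} D \<Rightarrow> 'p::complex_vector \<Rightarrow> 'p"
    and actV :: "'n gl \<Rightarrow> 'v::complex_vector \<Rightarrow> 'v"
  assumes "algebra_module actP" and "simple_module UNIV actP"
    and "lie_module gl_bracket actV" and "simple_module UNIV actV"
    and "reducible_module UNIV (T_act actP actV)"
  shows "\<exists>r\<in>{0..CARD('n)}. iso_V_delta r actV"
proof -
  obtain v where v: "v \<noteq> 0"
    "\<And>a b j l. sym_normal_product (\<lambda>i j. actV (matrix_unit i j)) a b j l v = 0"
    using reducible_imp_sym_normal_product_eq_0[OF assms(1,3,2,4,5)] by blast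
  show ?thesis
    by (rule iso_V_delta_if_sym_normal_product_eq_0[OF assms(3,4) sym_normal_product_eq_0[OF assms(3,4) v]])
qed

end
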